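(* Let $(M^{2m+1},\theta,J,h)$ be a pseudo-Hermitian manifold of pseudo-Kähler type, and let $\tau(X)=T_\nabla(\xi,X)$ where $\nabla$ is its canonical pseudo-Hermitian connection. Then the following conditions are equivalent: (i) $\tau=0$. (ii) $\xi$ is an infinitesimal CR automorphism. (iii) $(M,\mathcal F_\xi,h)$ is a Riemannian foliation, where $\mathcal F_\xi$ denotes the Reeb foliation determined by $\xi$.
   Context: All objects are smooth. For a $1$-form, $2d\theta(X,Y)=X(\theta(Y))-Y(\theta(X))-\theta([X,Y])$. A CR structure on an orientable manifold $M$ of dimension $2m+1$ is a complex rank-$m$ subbundle $H^{1,0}(M)\subset T(M)\otimes\mathbb C$ with $H^{1,0}(M)\cap H^{0,1}(M)=\{0\}$, where $H^{0,1}(M)=\overline{H^{1,0}(M)}$, and $[\Gamma(H^{1,0}(M)),\Gamma(H^{1,0}(M))]\subseteq\Gamma(H^{1,0}(M))$. Put $H(M)=\mathrm{Re}(H^{1,0}(M)\oplus H^{0,1}(M))$ and $J_b(Z+\overline Z)=\sqrt{-1}(Z-\overline Z)$ for $Z\in H^{1,0}(M)$. A pseudo-Hermitian $1$-form is a nowhere vanishing real $1$-form $\theta$ with $\ker\theta=H(M)$; its Levi form is $L_\theta(X,Y)=d\theta(X,J_bY)$ on $H(M)$. The CR manifold is non-degenerate if $L_\theta$ is non-degenerate. Then there is a unique (Reeb) vector field $\xi$ with $\theta(\xi)=1$, $i_\xi d\theta=0$; $T(M)=H(M)\oplus\mathbb R\xi$ with projection $\pi_H:T(M)\to H(M)$,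 and $J$ is the endomorphism of $T(M)$ with $J|_{H(M)}=J_b$, $J\xi=0$. A pseudo-Hermitian manifold $(M,\theta,J,h)$ is a non-degenerate CR manifold with a fixed pseudo-Hermitian $1$-form $\theta$ and a (positive definite) fiber metric $h$ on $H(M)$ with $h(J_bX,J_bY)=h(X,Y)$. The symbol $h$ also denotes the tensor $h(\pi_H\cdot,\pi_H\cdot)$ on $M$; $g_{h,\theta}=h+\theta\otimes\theta$ is a Riemannian metric. The pseudo-Kähler form is $\Omega_{h,\theta}(X,Y)=g_{h,\theta}(JX,Y)$; $M$ is of pseudo-Kähler type if $d\Omega_{h,\theta}=0$. There is the decomposition $T(M)\otimes\mathbb C=H^{1,0}(M)\oplus H^{0,1}(M)\oplus\mathbb C\xi$ with projections $\pi_+,\pi_-,\pi_0$. A pseudo-Hermitian connection is a linear connection $\nabla$ on $M$ preserving this decomposition and satisfying $\nabla g_{h,\theta}=0$. Its torsion is $T_\nabla(X,Y)=\nabla_XY-\nabla_YX-[X,Y]$, extended complex bilinearly. With $\Theta=\pi_+(T_\nabla(\cdot,\cdot))$, set $\Theta^{(1,1)}(Z,W)=\Theta(\pi_+Z,\pi_-W)+\Theta(\pi_-Z,\pi_+W)$. Also $\tau(X)=T_\nabla(\xi,X)$ and $\sigma=\tau\circ J+J\circ\tau$. The canonical pseudo-Hermitian connection is the unique pseudo-Hermitian connection with $\Theta^{(1,1)}=0$ and $h(\sigma(X),Y)=-h(X,\sigma(Y))$ for all $X,Y\in T(M)$. The Reeb foliation $\mathcal F_\xi$ is the one-dimensional foliation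 by integral curves of $\xi$. An infinitesimal CR automorphism is a real vector field whose local flow consists of local CR automorphisms; for $\xi$ this means $\mathcal L_\xi J=0$. $(M,\mathcal F_\xi,h)$ is a Riemannian foliation if $\mathcal L_\xi h=0$ ($h$ viewed as the tensor $h(\pi_H\cdot,\pi_H\cdot)$ on $M$). *)

theory Defs
  imports "HOL-Analysis.Analysis" "HOL-Library.Function_Algebras"
begin

section \<open>Smooth manifolds\<close>

text \<open>Of class \<open>C\<^sup>k\<close>; only used on open sets \<open>S\<close> of a finite-dimensional space, where the
  directional derivatives determine the derivative.\<close>

primrec Ck_on :: "nat \<Rightarrow> ('v::real_normed_vector \<Rightarrow> 'w::real_normed_vector) \<Rightarrow> 'v set \<Rightarrow> bool" where
  "Ck_on 0 f S \<longleftrightarrow> continuous_on S f"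
| "Ck_on (Suc k) f S \<longleftrightarrow>
     (\<forall>x\<in>S. f differentiable (at x)) \<and> (\<forall>v. Ck_on k (\<lambda>x. frechet_derivative f (at x) v) S)"

definition smooth_on :: "('v::real_normed_vector \<Rightarrow> 'w::real_normed_vector) \<Rightarrow> 'v set \<Rightarrow> bool" where
  "smooth_on f S \<longleftrightarrow> (\<forall>k. Ck_on k f S)"

type_synonym ('a, 'n) chart = "'a set \<times> ('a \<Rightarrow> real ^ 'n)"

definition chart_image :: "('a, 'n) chart \<Rightarrow> (real ^ 'n) set" where
  "chart_image c = snd c ` fst c"

definition chart_inv :: "('a, 'n) chart \<Rightarrow> real ^ 'n \<Rightarrow> 'a" where
  "chart_inv c = inv_into (fst c) (snd c)"

definition is_chart :: "('a::topological_space, 'n::finite) chart \<Rightarrow> bool" where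
  "is_chart c \<longleftrightarrow> open (fst c) \<and> open (chart_image c) \<and>
     homeomorphism (fst c) (chart_image c) (snd c) (chart_inv c)"

definition overlap :: "('a, 'n) chart \<Rightarrow> ('a, 'n) chart \<Rightarrow> (real ^ 'n) set" where
  "overlap c d = snd c ` (fst c \<inter> fst d)"

definition transition :: "('a, 'n) chart \<Rightarrow> ('a, 'n) chart \<Rightarrow> real ^ 'n \<Rightarrow> real ^ 'n" where
  "transition c d = snd d \<circ> chart_inv c"

text \<open>A smooth manifold is a type \<open>'a\<close> of sort \<open>{t2_space, second_countable_topology}\<close> with a
  smooth atlas \<open>A\<close>, which need not be maximal; its dimension is \<open>CARD('n)\<close>.\<close>

definition smooth_atlas ::
  "('a::{t2_space, second_countable_topology}, 'n::finite) chart set \<Rightarrow> bool" where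
  "smooth_atlas A \<longleftrightarrow> (\<forall>c\<in>A. is_chart c) \<and> (\<Union>c\<in>A. fst c) = UNIV \<and>
     (\<forall>c\<in>A. \<forall>d\<in>A. smooth_on (transition c d) (overlap c d))"

definition orientable ::
  "('a::{t2_space, second_countable_topology}, 'n::finite) chart set \<Rightarrow> bool" where
  "orientable A \<longleftrightarrow> (\<exists>B. smooth_atlas B \<and> smooth_atlas (A \<union> B) \<and>
     (\<forall>c\<in>B. \<forall>d\<in>B. \<forall>x\<in>overlap c d.
        0 < det (matrix (frechet_derivative (transition c d) (at x)))))"

definition smooth_fun ::
  "('a::topological_space, 'n::finite) chart set \<Rightarrow> ('a \<Rightarrow> 'b::real_normed_vector) \<Rightarrow> bool" where
  "smooth_fun A f \<longleftrightarrow> (\<forall>c\<in>A. smooth_on (f \<circ> chart_inv c) (chart_image c))"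


section \<open>Tangent vectors and vector fields\<close>

text \<open>Point derivations of the algebra of smooth real functions, with values in \<open>'b\<close>. For
  \<open>'b = real\<close> this is the tangent space at \<open>p\<close>; for \<open>'b = complex\<close> it is its complexification.
  Derivations vanish by convention outside the smooth functions, so that equality of tangent
  vectors is equality of functions. Sums, differences and zero of vectors and of vector fields are
  those of the theory \<open>Function_Algebras\<close>.\<close>

definition tangent_space ::
  "('a::topological_space, 'n::finite) chart set \<Rightarrow> 'a \<Rightarrow> (('a \<Rightarrow> real) \<Rightarrow> 'b::real_vector) set" where
  "tangent_space A p = {v.
     (\<forall>f g. smooth_fun A f \<and> smooth_fun A g \<longrightarrow> v (\<lambda>x. f x + g x) = v f + v g) \<and>
     (\<forall>r f. smooth_fun A f \<longrightarrow> v (\<lambda>x. r * f x) = r *\<^sub>R v f) \<and>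
     (\<forall>f g. smooth_fun A f \<and> smooth_fun A g \<longrightarrow>
        v (\<lambda>x. f x * g x) = f p *\<^sub>R v g + g p *\<^sub>R v f) \<and>
     (\<forall>f. \<not> smooth_fun A f \<longrightarrow> v f = 0)}"

type_synonym 'a tvec = "('a \<Rightarrow> real) \<Rightarrow> real"
type_synonym 'a ctvec = "('a \<Rightarrow> real) \<Rightarrow> complex"
type_synonym 'a vfield = "'a \<Rightarrow> 'a tvec"
type_synonym 'a cvfield = "'a \<Rightarrow> 'a ctvec"

definition scale_vec :: "'b::times \<Rightarrow> ('f \<Rightarrow> 'b) \<Rightarrow> 'f \<Rightarrow> 'b" where
  "scale_vec c v = (\<lambda>f. c * v f)"

definition scale_vf :: "('a \<Rightarrow> 'b::times) \<Rightarrow> ('a \<Rightarrow> 'f \<Rightarrow> 'b) \<Rightarrow> 'a \<Rightarrow> 'f \<Rightarrow> 'b" where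
  "scale_vf u X = (\<lambda>p. scale_vec (u p) (X p))"

definition smooth_vf ::
  "('a::topological_space, 'n::finite) chart set \<Rightarrow> ('a \<Rightarrow> ('a \<Rightarrow> real) \<Rightarrow> 'b::real_normed_vector) \<Rightarrow> bool" where
  "smooth_vf A X \<longleftrightarrow> (\<forall>p. X p \<in> tangent_space A p) \<and>
     (\<forall>f. smooth_fun A f \<longrightarrow> smooth_fun A (\<lambda>p. X p f))"

definition section_of ::
  "('a::topological_space, 'n::finite) chart set \<Rightarrow> ('a \<Rightarrow> (('a \<Rightarrow> real) \<Rightarrow> 'b::real_normed_vector) set)
     \<Rightarrow> ('a \<Rightarrow> ('a \<Rightarrow> real) \<Rightarrow> 'b) \<Rightarrow> bool" where
  "section_of A E X \<longleftrightarrow> smooth_vf A X \<and> (\<forall>p. X p \<in> E p)"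

definition bracket ::
  "('a::topological_space, 'n::finite) chart set \<Rightarrow> 'a vfield \<Rightarrow> 'a vfield \<Rightarrow> 'a vfield" where
  "bracket A X Y = (\<lambda>p f. if smooth_fun A f then X p (\<lambda>q. Y q f) - Y p (\<lambda>q. X q f) else 0)"

definition re_vec :: "'a ctvec \<Rightarrow> 'a tvec" where "re_vec v = (\<lambda>f. Re (v f))"
definition im_vec :: "'a ctvec \<Rightarrow> 'a tvec" where "im_vec v = (\<lambda>f. Im (v f))"
definition cx_vec :: "'a tvec \<Rightarrow> 'a ctvec" where "cx_vec v = (\<lambda>f. complex_of_real (v f))"
definition conj_vec :: "'a ctvec \<Rightarrow> 'a ctvec" where "conj_vec v = (\<lambda>f. cnj (v f))"

text \<open>Complex bilinear extension of a real bilinear operation on vector fields.\<close>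

definition cx_ext ::
  "('a vfield \<Rightarrow> 'a vfield \<Rightarrow> 'a vfield) \<Rightarrow> 'a cvfield \<Rightarrow> 'a cvfield \<Rightarrow> 'a cvfield" where
  "cx_ext B Z W = (\<lambda>p f. Complex
     (B (re_vec \<circ> Z) (re_vec \<circ> W) p f - B (im_vec \<circ> Z) (im_vec \<circ> W) p f)
     (B (re_vec \<circ> Z) (im_vec \<circ> W) p f + B (im_vec \<circ> Z) (re_vec \<circ> W) p f))"


section \<open>CR structures and pseudo-Hermitian forms\<close>

definition conj_bundle :: "('a \<Rightarrow> 'a ctvec set) \<Rightarrow> 'a \<Rightarrow> 'a ctvec set" where
  "conj_bundle H p = conj_vec ` H p"

text \<open>Local frames are taken to be restrictions of global vector fields, and involutivity is
  required of global sections; by bump functions neither is a restriction.\<close>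

definition complex_subbundle ::
  "('a::topological_space, 'n::finite) chart set \<Rightarrow> nat \<Rightarrow> ('a \<Rightarrow> 'a ctvec set) \<Rightarrow> bool" where
  "complex_subbundle A m H \<longleftrightarrow> (\<forall>p. \<exists>U Z. open U \<and> p \<in> U \<and>
     (\<forall>i<m. smooth_vf A (Z i)) \<and>
     (\<forall>q\<in>U. H q = {(\<lambda>f. \<Sum>i<m. c i * Z i q f) | c. True} \<and>
        (\<forall>c. (\<forall>f. (\<Sum>i<m. c i * Z i q f) = 0) \<longrightarrow> (\<forall>i<m. c i = 0))))"

definition cr_structure ::
  "('a::{t2_space, second_countable_topology}, 'n::finite) chart set \<Rightarrow> nat \<Rightarrow> ('a \<Rightarrow> 'a ctvec set) \<Rightarrow> bool" where
  "cr_structure A m H \<longleftrightarrow> smooth_atlas A \<and> orientable A \<and> CARD('n) = 2 * m + 1 \<and>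
     complex_subbundle A m H \<and> (\<forall>p. H p \<inter> conj_bundle H p = {0}) \<and>
     (\<forall>Z W. section_of A H Z \<and> section_of A H W \<longrightarrow> section_of A H (cx_ext (bracket A) Z W))"

text \<open>In the sequel \<open>H\<close> is the bundle \<open>H\<^sup>1\<^sup>,\<^sup>0(M)\<close>, and \<open>levi_dist H\<close> is \<open>H(M)\<close>.\<close>

definition levi_dist :: "('a \<Rightarrow> 'a ctvec set) \<Rightarrow> 'a \<Rightarrow> 'a tvec set" where
  "levi_dist H p = {re_vec (z + w) | z w. z \<in> H p \<and> w \<in> conj_bundle H p}"

definition J_b :: "('a \<Rightarrow> 'a ctvec set) \<Rightarrow> 'a \<Rightarrow> 'a tvec \<Rightarrow> 'a tvec" where
  "J_b H p v = (THE u. \<exists>z\<in>H p. cx_vec v = z + conj_vec z \<and>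
     cx_vec u = scale_vec \<i> (z - conj_vec z))"

definition one_form ::
  "('a::topological_space, 'n::finite) chart set \<Rightarrow> ('a \<Rightarrow> 'a tvec \<Rightarrow> real) \<Rightarrow> bool" where
  "one_form A \<theta> \<longleftrightarrow>
     (\<forall>p. \<forall>u\<in>tangent_space A p. \<forall>v\<in>tangent_space A p. \<theta> p (u + v) = \<theta> p u + \<theta> p v) \<and>
     (\<forall>p r. \<forall>u\<in>tangent_space A p. \<theta> p (scale_vec r u) = r * \<theta> p u) \<and>
     (\<forall>X. smooth_vf A X \<longrightarrow> smooth_fun A (\<lambda>p. \<theta> p (X p)))"

definition d_one ::
  "('a::topological_space, 'n::finite) chart set \<Rightarrow> ('a \<Rightarrow> 'a tvec \<Rightarrow> real) \<Rightarrow>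
     'a vfield \<Rightarrow> 'a vfield \<Rightarrow> 'a \<Rightarrow> real" where
  "d_one A \<theta> X Y p =
     (X p (\<lambda>q. \<theta> q (Y q)) - Y p (\<lambda>q. \<theta> q (X q)) - \<theta> p (bracket A X Y p)) / 2"

definition d_two ::
  "('a::topological_space, 'n::finite) chart set \<Rightarrow> ('a \<Rightarrow> 'a tvec \<Rightarrow> 'a tvec \<Rightarrow> real) \<Rightarrow>
     'a vfield \<Rightarrow> 'a vfield \<Rightarrow> 'a vfield \<Rightarrow> 'a \<Rightarrow> real" where
  "d_two A \<omega> X Y Z p =
     (X p (\<lambda>q. \<omega> q (Y q) (Z q)) + Y p (\<lambda>q. \<omega> q (Z q) (X q)) + Z p (\<lambda>q. \<omega> q (X q) (Y q))
      - \<omega> p (bracket A X Y p) (Z p) - \<omega> p (bracket A Y Z p) (X p) - \<omega> p (bracket A Z X p) (Y p)) / 3"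

definition pseudo_hermitian_form ::
  "('a::topological_space, 'n::finite) chart set \<Rightarrow> ('a \<Rightarrow> 'a ctvec set) \<Rightarrow> ('a \<Rightarrow> 'a tvec \<Rightarrow> real) \<Rightarrow> bool" where
  "pseudo_hermitian_form A H \<theta> \<longleftrightarrow> one_form A \<theta> \<and>
     (\<forall>p. \<exists>v\<in>tangent_space A p. \<theta> p v \<noteq> 0) \<and>
     (\<forall>p. {v \<in> tangent_space A p. \<theta> p v = 0} = levi_dist H p)"

definition levi_form ::
  "('a::topological_space, 'n::finite) chart set \<Rightarrow> ('a \<Rightarrow> 'a ctvec set) \<Rightarrow> ('a \<Rightarrow> 'a tvec \<Rightarrow> real) \<Rightarrow>
     'a vfield \<Rightarrow> 'a vfield \<Rightarrow> 'a \<Rightarrow> real" where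
  "levi_form A H \<theta> X Y = d_one A \<theta> X (\<lambda>p. J_b H p (Y p))"

text \<open>The Levi form is tensorial and every vector of \<open>H(M)\<close> extends to a global section, so this is
  non-degeneracy on each fibre.\<close>

definition levi_nondegenerate ::
  "('a::topological_space, 'n::finite) chart set \<Rightarrow> ('a \<Rightarrow> 'a ctvec set) \<Rightarrow> ('a \<Rightarrow> 'a tvec \<Rightarrow> real) \<Rightarrow> bool" where
  "levi_nondegenerate A H \<theta> \<longleftrightarrow> (\<forall>p X. section_of A (levi_dist H) X \<and>
     (\<forall>Y. section_of A (levi_dist H) Y \<longrightarrow> levi_form A H \<theta> X Y p = 0) \<longrightarrow> X p = 0)"

definition reeb_field ::
  "('a::topological_space, 'n::finite) chart set \<Rightarrow> ('a \<Rightarrow> 'a tvec \<Rightarrow> real) \<Rightarrow> 'a vfield \<Rightarrow> bool" where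
  "reeb_field A \<theta> \<xi> \<longleftrightarrow> smooth_vf A \<xi> \<and> (\<forall>p. \<theta> p (\<xi> p) = 1) \<and>
     (\<forall>X p. smooth_vf A X \<longrightarrow> d_one A \<theta> \<xi> X p = 0)"

text \<open>Smoothness and linearity of the extension \<open>J\<close> of \<open>J_b\<close> by \<open>J \<xi> = 0\<close> are part of its being an
  endomorphism of the tangent bundle.\<close>

definition cr_endomorphism ::
  "('a::topological_space, 'n::finite) chart set \<Rightarrow> ('a \<Rightarrow> 'a ctvec set) \<Rightarrow> 'a vfield \<Rightarrow>
     ('a \<Rightarrow> 'a tvec \<Rightarrow> 'a tvec) \<Rightarrow> bool" where
  "cr_endomorphism A H \<xi> J \<longleftrightarrow>
     (\<forall>p. \<forall>u\<in>tangent_space A p. J p u \<in> tangent_space A p) \<and>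
     (\<forall>p. \<forall>u\<in>tangent_space A p. \<forall>v\<in>tangent_space A p. J p (u + v) = J p u + J p v) \<and>
     (\<forall>p r. \<forall>u\<in>tangent_space A p. J p (scale_vec r u) = scale_vec r (J p u)) \<and>
     (\<forall>X. smooth_vf A X \<longrightarrow> smooth_vf A (\<lambda>p. J p (X p))) \<and>
     (\<forall>p. \<forall>v\<in>levi_dist H p. J p v = J_b H p v) \<and>
     (\<forall>p. J p (\<xi> p) = 0)"

definition hermitian_fiber_metric ::
  "('a::topological_space, 'n::finite) chart set \<Rightarrow> ('a \<Rightarrow> 'a ctvec set) \<Rightarrow>
     ('a \<Rightarrow> 'a tvec \<Rightarrow> 'a tvec \<Rightarrow> real) \<Rightarrow> bool" where
  "hermitian_fiber_metric A H h \<longleftrightarrow>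
     (\<forall>p. \<forall>u\<in>levi_dist H p. \<forall>v\<in>levi_dist H p. \<forall>w\<in>levi_dist H p. h p (u + v) w = h p u w + h p v w) \<and>
     (\<forall>p r. \<forall>u\<in>levi_dist H p. \<forall>v\<in>levi_dist H p. h p (scale_vec r u) v = r * h p u v) \<and>
     (\<forall>p. \<forall>u\<in>levi_dist H p. \<forall>v\<in>levi_dist H p. h p u v = h p v u) \<and>
     (\<forall>p. \<forall>u\<in>levi_dist H p. u \<noteq> 0 \<longrightarrow> 0 < h p u u) \<and>
     (\<forall>X Y. section_of A (levi_dist H) X \<and> section_of A (levi_dist H) Y \<longrightarrow>
        smooth_fun A (\<lambda>p. h p (X p) (Y p))) \<and>
     (\<forall>p. \<forall>u\<in>levi_dist H p. \<forall>v\<in>levi_dist H p. h p (J_b H p u) (J_b H p v) = h p u v)"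

definition pseudo_hermitian_manifold ::
  "('a::{t2_space, second_countable_topology}, 'n::finite) chart set \<Rightarrow> nat \<Rightarrow> ('a \<Rightarrow> 'a ctvec set) \<Rightarrow>
     ('a \<Rightarrow> 'a tvec \<Rightarrow> real) \<Rightarrow> 'a vfield \<Rightarrow> ('a \<Rightarrow> 'a tvec \<Rightarrow> 'a tvec) \<Rightarrow>
     ('a \<Rightarrow> 'a tvec \<Rightarrow> 'a tvec \<Rightarrow> real) \<Rightarrow> bool" where
  "pseudo_hermitian_manifold A m H \<theta> \<xi> J h \<longleftrightarrow>
     cr_structure A m H \<and> pseudo_hermitian_form A H \<theta> \<and> levi_nondegenerate A H \<theta> \<and>
     reeb_field A \<theta> \<xi> \<and> cr_endomorphism A H \<xi> J \<and> hermitian_fiber_metric A H h"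

definition pi_H :: "('a \<Rightarrow> 'a ctvec set) \<Rightarrow> 'a vfield \<Rightarrow> 'a \<Rightarrow> 'a tvec \<Rightarrow> 'a tvec" where
  "pi_H H \<xi> p v = (THE w. w \<in> levi_dist H p \<and> (\<exists>r. v = w + scale_vec r (\<xi> p)))"

definition h_tensor ::
  "('a \<Rightarrow> 'a ctvec set) \<Rightarrow> 'a vfield \<Rightarrow> ('a \<Rightarrow> 'a tvec \<Rightarrow> 'a tvec \<Rightarrow> real) \<Rightarrow>
     'a \<Rightarrow> 'a tvec \<Rightarrow> 'a tvec \<Rightarrow> real" where
  "h_tensor H \<xi> h p u v = h p (pi_H H \<xi> p u) (pi_H H \<xi> p v)"

definition g_metric ::
  "('a \<Rightarrow> 'a ctvec set) \<Rightarrow> ('a \<Rightarrow> 'a tvec \<Rightarrow> real) \<Rightarrow> 'a vfield \<Rightarrow>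
     ('a \<Rightarrow> 'a tvec \<Rightarrow> 'a tvec \<Rightarrow> real) \<Rightarrow> 'a \<Rightarrow> 'a tvec \<Rightarrow> 'a tvec \<Rightarrow> real" where
  "g_metric H \<theta> \<xi> h p u v = h_tensor H \<xi> h p u v + \<theta> p u * \<theta> p v"

definition pseudo_kahler_form ::
  "('a \<Rightarrow> 'a ctvec set) \<Rightarrow> ('a \<Rightarrow> 'a tvec \<Rightarrow> real) \<Rightarrow> 'a vfield \<Rightarrow> ('a \<Rightarrow> 'a tvec \<Rightarrow> 'a tvec) \<Rightarrow>
     ('a \<Rightarrow> 'a tvec \<Rightarrow> 'a tvec \<Rightarrow> real) \<Rightarrow> 'a \<Rightarrow> 'a tvec \<Rightarrow> 'a tvec \<Rightarrow> real" where
  "pseudo_kahler_form H \<theta> \<xi> J h p u v = g_metric H \<theta> \<xi> h p (J p u) v"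

definition pseudo_kahler_type ::
  "('a::topological_space, 'n::finite) chart set \<Rightarrow> ('a \<Rightarrow> 'a ctvec set) \<Rightarrow>
     ('a \<Rightarrow> 'a tvec \<Rightarrow> real) \<Rightarrow> 'a vfield \<Rightarrow> ('a \<Rightarrow> 'a tvec \<Rightarrow> 'a tvec) \<Rightarrow>
     ('a \<Rightarrow> 'a tvec \<Rightarrow> 'a tvec \<Rightarrow> real) \<Rightarrow> bool" where
  "pseudo_kahler_type A H \<theta> \<xi> J h \<longleftrightarrow> (\<forall>X Y Z p. smooth_vf A X \<and> smooth_vf A Y \<and> smooth_vf A Z \<longrightarrow>
     d_two A (pseudo_kahler_form H \<theta> \<xi> J h) X Y Z p = 0)"


section \<open>Connections\<close>

definition linear_connection ::
  "('a::topological_space, 'n::finite) chart set \<Rightarrow> ('a vfield \<Rightarrow> 'a vfield \<Rightarrow> 'a vfield) \<Rightarrow> bool" where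
  "linear_connection A N \<longleftrightarrow>
     (\<forall>X Y. smooth_vf A X \<and> smooth_vf A Y \<longrightarrow> smooth_vf A (N X Y)) \<and>
     (\<forall>X X' Y. smooth_vf A X \<and> smooth_vf A X' \<and> smooth_vf A Y \<longrightarrow> N (X + X') Y = N X Y + N X' Y) \<and>
     (\<forall>X Y Y'. smooth_vf A X \<and> smooth_vf A Y \<and> smooth_vf A Y' \<longrightarrow> N X (Y + Y') = N X Y + N X Y') \<and>
     (\<forall>u X Y. smooth_fun A u \<and> smooth_vf A X \<and> smooth_vf A Y \<longrightarrow>
        N (scale_vf u X) Y = scale_vf u (N X Y)) \<and>
     (\<forall>u X Y. smooth_fun A u \<and> smooth_vf A X \<and> smooth_vf A Y \<longrightarrow>
        N X (scale_vf u Y) = scale_vf u (N X Y) + scale_vf (\<lambda>p. X p u) Y)"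

definition preserves_bundle ::
  "('a::topological_space, 'n::finite) chart set \<Rightarrow> ('a vfield \<Rightarrow> 'a vfield \<Rightarrow> 'a vfield) \<Rightarrow>
     ('a \<Rightarrow> 'a ctvec set) \<Rightarrow> bool" where
  "preserves_bundle A N E \<longleftrightarrow> (\<forall>X Z. smooth_vf A X \<and> section_of A E Z \<longrightarrow>
     section_of A E (cx_ext N (cx_vec \<circ> X) Z))"

definition reeb_line :: "'a vfield \<Rightarrow> 'a \<Rightarrow> 'a ctvec set" where
  "reeb_line \<xi> p = {scale_vec c (cx_vec (\<xi> p)) | c. True}"

definition preserves_metric ::
  "('a::topological_space, 'n::finite) chart set \<Rightarrow> ('a vfield \<Rightarrow> 'a vfield \<Rightarrow> 'a vfield) \<Rightarrow>
     ('a \<Rightarrow> 'a tvec \<Rightarrow> 'a tvec \<Rightarrow> real) \<Rightarrow> bool" where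
  "preserves_metric A N g \<longleftrightarrow> (\<forall>X Y Z p. smooth_vf A X \<and> smooth_vf A Y \<and> smooth_vf A Z \<longrightarrow>
     X p (\<lambda>q. g q (Y q) (Z q)) = g p (N X Y p) (Z p) + g p (Y p) (N X Z p))"

definition pseudo_hermitian_connection ::
  "('a::topological_space, 'n::finite) chart set \<Rightarrow> ('a \<Rightarrow> 'a ctvec set) \<Rightarrow>
     ('a \<Rightarrow> 'a tvec \<Rightarrow> real) \<Rightarrow> 'a vfield \<Rightarrow> ('a \<Rightarrow> 'a tvec \<Rightarrow> 'a tvec \<Rightarrow> real) \<Rightarrow>
     ('a vfield \<Rightarrow> 'a vfield \<Rightarrow> 'a vfield) \<Rightarrow> bool" where
  "pseudo_hermitian_connection A H \<theta> \<xi> h N \<longleftrightarrow> linear_connection A N \<and>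
     preserves_bundle A N H \<and> preserves_bundle A N (conj_bundle H) \<and>
     preserves_bundle A N (reeb_line \<xi>) \<and> preserves_metric A N (g_metric H \<theta> \<xi> h)"

definition torsion ::
  "('a::topological_space, 'n::finite) chart set \<Rightarrow> ('a vfield \<Rightarrow> 'a vfield \<Rightarrow> 'a vfield) \<Rightarrow>
     'a vfield \<Rightarrow> 'a vfield \<Rightarrow> 'a vfield" where
  "torsion A N X Y = N X Y - N Y X - bracket A X Y"

definition pi_plus :: "('a \<Rightarrow> 'a ctvec set) \<Rightarrow> 'a vfield \<Rightarrow> 'a \<Rightarrow> 'a ctvec \<Rightarrow> 'a ctvec" where
  "pi_plus H \<xi> p v = (THE z. z \<in> H p \<and> (\<exists>w\<in>conj_bundle H p. \<exists>t\<in>reeb_line \<xi> p. v = z + w + t))"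

definition pi_minus :: "('a \<Rightarrow> 'a ctvec set) \<Rightarrow> 'a vfield \<Rightarrow> 'a \<Rightarrow> 'a ctvec \<Rightarrow> 'a ctvec" where
  "pi_minus H \<xi> p v = (THE w. w \<in> conj_bundle H p \<and> (\<exists>z\<in>H p. \<exists>t\<in>reeb_line \<xi> p. v = z + w + t))"

definition Theta ::
  "('a::topological_space, 'n::finite) chart set \<Rightarrow> ('a \<Rightarrow> 'a ctvec set) \<Rightarrow> 'a vfield \<Rightarrow>
     ('a vfield \<Rightarrow> 'a vfield \<Rightarrow> 'a vfield) \<Rightarrow> 'a cvfield \<Rightarrow> 'a cvfield \<Rightarrow> 'a cvfield" where
  "Theta A H \<xi> N Z W = (\<lambda>p. pi_plus H \<xi> p (cx_ext (torsion A N) Z W p))"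

definition Theta_11 ::
  "('a::topological_space, 'n::finite) chart set \<Rightarrow> ('a \<Rightarrow> 'a ctvec set) \<Rightarrow> 'a vfield \<Rightarrow>
     ('a vfield \<Rightarrow> 'a vfield \<Rightarrow> 'a vfield) \<Rightarrow> 'a cvfield \<Rightarrow> 'a cvfield \<Rightarrow> 'a cvfield" where
  "Theta_11 A H \<xi> N Z W =
     Theta A H \<xi> N (\<lambda>p. pi_plus H \<xi> p (Z p)) (\<lambda>p. pi_minus H \<xi> p (W p)) +
     Theta A H \<xi> N (\<lambda>p. pi_minus H \<xi> p (Z p)) (\<lambda>p. pi_plus H \<xi> p (W p))"

definition tau ::
  "('a::topological_space, 'n::finite) chart set \<Rightarrow> 'a vfield \<Rightarrow>
     ('a vfield \<Rightarrow> 'a vfield \<Rightarrow> 'a vfield) \<Rightarrow> 'a vfield \<Rightarrow> 'a vfield" where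
  "tau A \<xi> N X = torsion A N \<xi> X"

definition sigma ::
  "('a::topological_space, 'n::finite) chart set \<Rightarrow> 'a vfield \<Rightarrow> ('a \<Rightarrow> 'a tvec \<Rightarrow> 'a tvec) \<Rightarrow>
     ('a vfield \<Rightarrow> 'a vfield \<Rightarrow> 'a vfield) \<Rightarrow> 'a vfield \<Rightarrow> 'a vfield" where
  "sigma A \<xi> J N X = tau A \<xi> N (\<lambda>p. J p (X p)) + (\<lambda>p. J p (tau A \<xi> N X p))"

definition canonical_connection ::
  "('a::topological_space, 'n::finite) chart set \<Rightarrow> ('a \<Rightarrow> 'a ctvec set) \<Rightarrow>
     ('a \<Rightarrow> 'a tvec \<Rightarrow> real) \<Rightarrow> 'a vfield \<Rightarrow> ('a \<Rightarrow> 'a tvec \<Rightarrow> 'a tvec) \<Rightarrow>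
     ('a \<Rightarrow> 'a tvec \<Rightarrow> 'a tvec \<Rightarrow> real) \<Rightarrow> ('a vfield \<Rightarrow> 'a vfield \<Rightarrow> 'a vfield) \<Rightarrow> bool" where
  "canonical_connection A H \<theta> \<xi> J h N \<longleftrightarrow> pseudo_hermitian_connection A H \<theta> \<xi> h N \<and>
     (\<forall>Z W. smooth_vf A Z \<and> smooth_vf A W \<longrightarrow> Theta_11 A H \<xi> N Z W = 0) \<and>
     (\<forall>X Y p. smooth_vf A X \<and> smooth_vf A Y \<longrightarrow>
        h_tensor H \<xi> h p (sigma A \<xi> J N X p) (Y p) = - h_tensor H \<xi> h p (X p) (sigma A \<xi> J N Y p))"


section \<open>Lie derivatives along the Reeb field\<close>

definition lie_endo ::
  "('a::topological_space, 'n::finite) chart set \<Rightarrow> 'a vfield \<Rightarrow> ('a \<Rightarrow> 'a tvec \<Rightarrow> 'a tvec) \<Rightarrow>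
     'a vfield \<Rightarrow> 'a vfield" where
  "lie_endo A V J X = bracket A V (\<lambda>p. J p (X p)) - (\<lambda>p. J p (bracket A V X p))"

definition lie_two_tensor ::
  "('a::topological_space, 'n::finite) chart set \<Rightarrow> 'a vfield \<Rightarrow>
     ('a \<Rightarrow> 'a tvec \<Rightarrow> 'a tvec \<Rightarrow> real) \<Rightarrow> 'a vfield \<Rightarrow> 'a vfield \<Rightarrow> 'a \<Rightarrow> real" where
  "lie_two_tensor A V b X Y p =
     V p (\<lambda>q. b q (X q) (Y q)) - b p (bracket A V X p) (Y p) - b p (X p) (bracket A V Y p)"

text \<open>For the Reeb field, being an infinitesimal CR automorphism means that the Lie derivative of \<open>J\<close>
  along it vanishes; its orbit foliation is Riemannian for \<open>h\<close> if that of the tensor \<open>h\<close> vanishes.\<close>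

definition reeb_infinitesimal_CR_automorphism ::
  "('a::topological_space, 'n::finite) chart set \<Rightarrow> 'a vfield \<Rightarrow> ('a \<Rightarrow> 'a tvec \<Rightarrow> 'a tvec) \<Rightarrow> bool" where
  "reeb_infinitesimal_CR_automorphism A \<xi> J \<longleftrightarrow> (\<forall>X. smooth_vf A X \<longrightarrow> lie_endo A \<xi> J X = 0)"

definition reeb_riemannian_foliation ::
  "('a::topological_space, 'n::finite) chart set \<Rightarrow> ('a \<Rightarrow> 'a ctvec set) \<Rightarrow> 'a vfield \<Rightarrow>
     ('a \<Rightarrow> 'a tvec \<Rightarrow> 'a tvec \<Rightarrow> real) \<Rightarrow> bool" where
  "reeb_riemannian_foliation A H \<xi> h \<longleftrightarrow> (\<forall>X Y p. smooth_vf A X \<and> smooth_vf A Y \<longrightarrow>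
     lie_two_tensor A \<xi> (h_tensor H \<xi> h) X Y p = 0)"

end

theory Submission
  imports Defs
begin

text \<open>
  Everything reduces to the single endomorphism \<open>\<tau>\<close>. An adapted connection makes \<open>\<xi>\<close>, \<open>\<theta>\<close>, the
  transverse metric \<open>k = h(\<pi>\<^sub>H\<cdot>, \<pi>\<^sub>H\<cdot>)\<close> and \<open>J\<close> parallel (\<open>N_xi\<close>, \<open>N_theta\<close>, \<open>N_k\<close>, \<open>N_J\<close>), so that
  \<open>\<tau>(X) = \<nabla>\<^sub>\<xi>X - [\<xi>, X]\<close> measures the difference between the covariant and the Lie derivative along
  \<open>\<xi>\<close>. It takes values in \<open>H(M)\<close> because \<open>i\<^sub>\<xi>d\<theta> = 0\<close>. Applied to the parallel tensors \<open>J\<close> and \<open>k\<close>, this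
  gives \<open>(L\<^sub>\<xi>J)(X) = J\<tau>X - \<tau>JX\<close> and \<open>(L\<^sub>\<xi>k)(X, Y) = k(\<tau>X, Y) + k(X, \<tau>Y)\<close> (\<open>lie_endo_J\<close>, \<open>lie_k\<close>).

  If \<open>\<Omega> = k(J\<cdot>, \<cdot>)\<close> is closed, then \<open>d\<Omega>(\<xi>, X, Y) = 0\<close> says \<open>k(J\<tau>X, Y) + k(JX, \<tau>Y) = 0\<close>
  (\<open>kahler_tau\<close>). Since \<open>J\<close> is skew for \<open>k\<close>, this makes \<open>\<sigma> = \<tau>J + J\<tau>\<close> symmetric
  (\<open>sigma_symmetric\<close>). The canonical connection has \<open>\<sigma>\<close> skew, so \<open>\<sigma> = 0\<close>: \<open>\<tau>\<close> anticommutes with \<open>J\<close>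
  (\<open>tau_J\<close>), and the same identity then shows that \<open>\<tau>\<close> is symmetric (\<open>tau_symmetric\<close>). Hence
  \<open>L\<^sub>\<xi>J = 2J\<tau>\<close> and \<open>L\<^sub>\<xi>k = 2k(\<tau>\<cdot>, \<cdot>)\<close>, and each of them vanishes exactly when \<open>\<tau>\<close> does, because \<open>J\<close> is
  injective on \<open>H(M)\<close> and \<open>k\<close> is definite there.

  All identities are tested on global vector fields: a vector that is to be shown zero is the value
  of a smooth horizontal field, and that field itself serves as the test field.
\<close>

section \<open>Closure properties of smooth functions\<close>

lemma Ck_on_cong:
  assumes "open S" "\<And>x. x \<in> S \<Longrightarrow> f x = g x" "Ck_on k f S"
  shows "Ck_on k g S"
  using assms(2,3)
proof (induction k arbitrary: f g)
  case 0
  then show ?case using continuous_on_cong[of S S f g] by simp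
next
  case (Suc k)
  have "g differentiable (at x)" if "x \<in> S" for x
  proof -
    have "f differentiable (at x)" using Suc.prems(2) that by simp
    then obtain f' where f': "(f has_derivative f') (at x)" unfolding differentiable_def by (elim exE)
    have "(g has_derivative f') (at x)"
      by (rule has_derivative_transform_within_open[OF f' assms(1) that Suc.prems(1)])
    then show ?thesis by (rule differentiableI)
  qed
  moreover have "Ck_on k (\<lambda>x. frechet_derivative g (at x) v) S" for v
  proof (rule Suc.IH)
    show "Ck_on k (\<lambda>x. frechet_derivative f (at x) v) S" using Suc.prems(2) by simp
    fix x assume x: "x \<in> S"
    then have "f differentiable (at x)" using Suc.prems(2) by simp
    then have "frechet_derivative f (at x) = frechet_derivative g (at x)"
      by (rule frechet_derivative_transform_within_open[OF _ assms(1) x Suc.prems(1)])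
    then show "frechet_derivative f (at x) v = frechet_derivative g (at x) v" by simp
  qed
  ultimately show ?case by simp
qed

text \<open>On an open set any family of derivatives may stand for the Frechet derivatives, which agree with
  it only on that set; this is the form in which the induction on the order is carried out.\<close>

lemma Ck_on_SucI:
  assumes "open S" "\<And>x. x \<in> S \<Longrightarrow> (f has_derivative f' x) (at x)"
    and "\<And>v. Ck_on k (\<lambda>x. f' x v) S"
  shows "Ck_on (Suc k) f S"
proof -
  have "f' x = frechet_derivative f (at x)" if "x \<in> S" for x
    using frechet_derivative_at assms(2)[OF that] by blast
  then have "Ck_on k (\<lambda>x. frechet_derivative f (at x) v) S" for v
    by (intro Ck_on_cong[OF assms(1) _ assms(3)[of v]]) simp
  then show ?thesis using assms(2) by (auto simp: differentiable_def)
qed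

lemma Ck_on_Suc_has_derivative:
  assumes "Ck_on (Suc k) f S" "x \<in> S"
  shows "(f has_derivative frechet_derivative f (at x)) (at x)"
  using assms frechet_derivative_works by auto

lemma Ck_on_lower: "Ck_on (Suc k) f S \<Longrightarrow> Ck_on k f S"
proof (induction k arbitrary: f)
  case 0
  then have "f differentiable_on S"
    by (simp add: differentiable_on_def differentiable_at_withinI)
  then show ?case by (simp add: differentiable_imp_continuous_on)
next
  case (Suc k)
  have "\<forall>x\<in>S. f differentiable (at x)" using Suc.prems by simp
  moreover have "Ck_on k (\<lambda>x. frechet_derivative f (at x) v) S" for v
    using Suc.prems by (intro Suc.IH) auto
  ultimately show ?case by simp
qed

lemma Ck_on_const: "Ck_on k (\<lambda>_. c) S"
  by (induction k arbitrary: c) (auto simp: frechet_derivative_const)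

lemma Ck_on_add:
  assumes "open S"
  shows "Ck_on k f S \<Longrightarrow> Ck_on k g S \<Longrightarrow> Ck_on k (\<lambda>x. f x + g x) S"
proof (induction k arbitrary: f g)
  case 0
  then show ?case by (auto intro: continuous_intros)
next
  case (Suc k)
  show ?case
  proof (rule Ck_on_SucI[OF assms])
    show "((\<lambda>x. f x + g x) has_derivative
        (\<lambda>v. frechet_derivative f (at x) v + frechet_derivative g (at x) v)) (at x)"
      if "x \<in> S" for x
      by (intro has_derivative_add Ck_on_Suc_has_derivative[OF _ that]) (fact Suc.prems)+
    show "Ck_on k (\<lambda>x. frechet_derivative f (at x) v + frechet_derivative g (at x) v) S" for v
      using Suc by simp
  qed
qed

lemma Ck_on_scaleR:
  fixes f :: "'v::real_normed_vector \<Rightarrow> real" and g :: "'v \<Rightarrow> 'w::real_normed_vector"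
  assumes "open S"
  shows "Ck_on k f S \<Longrightarrow> Ck_on k g S \<Longrightarrow> Ck_on k (\<lambda>x. f x *\<^sub>R g x) S"
proof (induction k arbitrary: f g)
  case 0
  then show ?case by (auto intro: continuous_intros)
next
  case (Suc k)
  show ?case
  proof (rule Ck_on_SucI[OF assms])
    show "((\<lambda>x. f x *\<^sub>R g x) has_derivative
        (\<lambda>v. f x *\<^sub>R frechet_derivative g (at x) v + frechet_derivative f (at x) v *\<^sub>R g x)) (at x)"
      if "x \<in> S" for x
      by (intro has_derivative_scaleR Ck_on_Suc_has_derivative[OF _ that]) (fact Suc.prems)+
    show "Ck_on k (\<lambda>x. f x *\<^sub>R frechet_derivative g (at x) v +
        frechet_derivative f (at x) v *\<^sub>R g x) S" for v
      using Suc.prems Ck_on_lower[OF Suc.prems(1)] Ck_on_lower[OF Suc.prems(2)]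
      by (intro Ck_on_add[OF assms] Suc.IH) auto
  qed
qed

section \<open>Vector fields on a smooth manifold\<close>

locale smooth_manifold =
  fixes A :: "('a::{t2_space, second_countable_topology}, 'n::finite) chart set"
  assumes atlas: "smooth_atlas A"
begin

lemma open_chart_image: "c \<in> A \<Longrightarrow> open (chart_image c)"
  using atlas by (auto simp: smooth_atlas_def is_chart_def)

lemma smooth_fun_const [simp]: "smooth_fun A (\<lambda>_. c)"
  by (simp add: smooth_fun_def smooth_on_def o_def Ck_on_const)

lemma smooth_fun_add:
  "smooth_fun A f \<Longrightarrow> smooth_fun A g \<Longrightarrow> smooth_fun A (\<lambda>x. f x + g x)"
  by (simp add: smooth_fun_def smooth_on_def o_def Ck_on_add open_chart_image)

lemma smooth_fun_scaleR:
  "smooth_fun A f \<Longrightarrow> smooth_fun A g \<Longrightarrow> smooth_fun A (\<lambda>x. f x *\<^sub>R g x)"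
  by (simp add: smooth_fun_def smooth_on_def o_def open_chart_image Ck_on_scaleR)

lemma smooth_fun_mult:
  fixes f g :: "'a \<Rightarrow> real"
  shows "smooth_fun A f \<Longrightarrow> smooth_fun A g \<Longrightarrow> smooth_fun A (\<lambda>x. f x * g x)"
  using smooth_fun_scaleR[of f g] by simp

lemma smooth_fun_diff:
  fixes f g :: "'a \<Rightarrow> real"
  shows "smooth_fun A f \<Longrightarrow> smooth_fun A g \<Longrightarrow> smooth_fun A (\<lambda>x. f x - g x)"
  using smooth_fun_add[of f "\<lambda>x. (-1) * g x"] smooth_fun_mult[of "\<lambda>_. -1" g] by simp

text \<open>Real and imaginary parts are recombined by the \<open>\<real>\<close>-linear structure of \<open>\<complex>\<close>, so that only sums and
  real multiples of smooth functions occur.\<close>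

lemma smooth_fun_Complex:
  assumes "smooth_fun A f" "smooth_fun A g"
  shows "smooth_fun A (\<lambda>x. Complex (f x) (g x))"
proof -
  have "(\<lambda>x. Complex (f x) (g x)) = (\<lambda>x. f x *\<^sub>R 1 + g x *\<^sub>R \<i>)"
    by (auto simp: complex_eq_iff)
  then show ?thesis using assms by (simp add: smooth_fun_add smooth_fun_scaleR)
qed

abbreviation TM :: "'a \<Rightarrow> 'a tvec set" where "TM \<equiv> tangent_space A"

lemma tangent_add: "u \<in> TM p \<Longrightarrow> v \<in> TM p \<Longrightarrow> u + v \<in> TM p"
  by (simp add: tangent_space_def algebra_simps)

lemma tangent_scale: "u \<in> TM p \<Longrightarrow> scale_vec r u \<in> TM p"
  by (simp add: tangent_space_def scale_vec_def algebra_simps)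

lemma tangent_diff: "u \<in> TM p \<Longrightarrow> v \<in> TM p \<Longrightarrow> u - v \<in> TM p"
  by (simp add: tangent_space_def algebra_simps)

lemma tangent_zero [simp]: "0 \<in> TM p"
  by (simp add: tangent_space_def)

lemma tangent_plus_fun:
  "v \<in> TM p \<Longrightarrow> smooth_fun A f \<Longrightarrow> smooth_fun A g \<Longrightarrow> v (\<lambda>x. f x + g x) = v f + v g"
  by (simp add: tangent_space_def)

lemma tangent_leibniz:
  "v \<in> TM p \<Longrightarrow> smooth_fun A f \<Longrightarrow> smooth_fun A g \<Longrightarrow>
    v (\<lambda>x. f x * g x) = f p * v g + g p * v f"
  by (simp add: tangent_space_def)

lemma tangent_smult_fun:
  "v \<in> TM p \<Longrightarrow> smooth_fun A f \<Longrightarrow> v (\<lambda>x. r * f x) = r * v f"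
  by (simp add: tangent_space_def)

lemma tangent_const:
  assumes "v \<in> TM p"
  shows "v (\<lambda>_. c) = 0"
proof -
  have "v (\<lambda>_. 1) = 0" using tangent_leibniz[OF assms, of "\<lambda>_. 1" "\<lambda>_. 1"] by simp
  then show ?thesis using tangent_smult_fun[OF assms, of "\<lambda>_. 1" c] by simp
qed

abbreviation vf :: "'a vfield \<Rightarrow> bool" where "vf \<equiv> smooth_vf A"

lemma vf_tangent: "vf X \<Longrightarrow> X p \<in> TM p"
  by (simp add: smooth_vf_def)

lemma vf_smooth: "vf X \<Longrightarrow> smooth_fun A f \<Longrightarrow> smooth_fun A (\<lambda>p. X p f)"
  by (simp add: smooth_vf_def)

lemma vf_diff: "vf X \<Longrightarrow> vf Y \<Longrightarrow> vf (X - Y)"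
  by (simp add: smooth_vf_def tangent_diff smooth_fun_diff)

lemma vf_add: "vf X \<Longrightarrow> vf Y \<Longrightarrow> vf (X + Y)"
  by (simp add: smooth_vf_def tangent_add smooth_fun_add)

lemma vf_zero: "vf 0"
  by (simp add: smooth_vf_def)

lemma vf_scale: "smooth_fun A u \<Longrightarrow> vf X \<Longrightarrow> vf (scale_vf u X)"
  unfolding smooth_vf_def scale_vf_def
  by (simp add: tangent_scale) (simp add: smooth_fun_mult scale_vec_def)

text \<open>The products of first derivatives in \<open>XY(fg)\<close> are symmetric in \<open>X\<close> and \<open>Y\<close>; they cancel in the
  commutator, which is therefore again a derivation.\<close>

lemma vf_bracket:
  assumes X: "vf X" and Y: "vf Y"
  shows "vf (bracket A X Y)"
proof -
  have sm: "smooth_fun A (\<lambda>q. X q f)" "smooth_fun A (\<lambda>q. Y q f)" if "smooth_fun A f" for f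
    using that X Y by (auto intro: vf_smooth)
  have "bracket A X Y p \<in> TM p" for p
  proof -
    note plus = vf_tangent[OF X, THEN tangent_plus_fun] vf_tangent[OF Y, THEN tangent_plus_fun]
    note smult = vf_tangent[OF X, THEN tangent_smult_fun] vf_tangent[OF Y, THEN tangent_smult_fun]
    note leibniz = vf_tangent[OF X, THEN tangent_leibniz] vf_tangent[OF Y, THEN tangent_leibniz]
    have "bracket A X Y p (\<lambda>x. f x + g x) = bracket A X Y p f + bracket A X Y p g"
      if "smooth_fun A f" "smooth_fun A g" for f g
      using that by (simp add: bracket_def smooth_fun_add sm plus)
    moreover have "bracket A X Y p (\<lambda>x. r * f x) = r * bracket A X Y p f"
      if "smooth_fun A f" for f r
      using that by (simp add: bracket_def smooth_fun_mult sm smult right_diff_distrib)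
    moreover have "bracket A X Y p (\<lambda>x. f x * g x) =
        f p * bracket A X Y p g + g p * bracket A X Y p f"
      if "smooth_fun A f" "smooth_fun A g" for f g
    proof -
      have "bracket A X Y p (\<lambda>x. f x * g x) =
          X p (\<lambda>q. f q * Y q g + g q * Y q f) - Y p (\<lambda>q. f q * X q g + g q * X q f)"
        using that by (simp add: bracket_def smooth_fun_mult leibniz)
      also have "\<dots> = X p (\<lambda>q. f q * Y q g) + X p (\<lambda>q. g q * Y q f)
          - (Y p (\<lambda>q. f q * X q g) + Y p (\<lambda>q. g q * X q f))"
        using that by (simp only: plus smooth_fun_mult sm)
      also have "\<dots> = f p * bracket A X Y p g + g p * bracket A X Y p f"
        using that by (simp only: leibniz sm bracket_def if_True) (simp add: algebra_simps)
      finally show ?thesis .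
    qed
    ultimately show ?thesis by (simp add: tangent_space_def bracket_def)
  qed
  moreover have "smooth_fun A (\<lambda>p. bracket A X Y p f)" if "smooth_fun A f" for f
    using that by (simp add: bracket_def smooth_fun_diff X Y vf_smooth)
  ultimately show ?thesis by (simp add: smooth_vf_def)
qed

lemma bracket_swap: "bracket A Y X p = scale_vec (-1) (bracket A X Y p)"
  by (auto simp: bracket_def scale_vec_def)

end

definition cpx_vec :: "'a tvec \<Rightarrow> 'a tvec \<Rightarrow> 'a ctvec" where
  "cpx_vec a b = (\<lambda>f. Complex (a f) (b f))"

lemma (in smooth_manifold) smooth_vf_cpx_vec:
  assumes "vf X" "vf Y"
  shows "smooth_vf A (\<lambda>p. cpx_vec (X p) (Y p))"
proof -
  have "cpx_vec (X p) (Y p) \<in> tangent_space A p" for p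
    using vf_tangent[OF assms(1), of p] vf_tangent[OF assms(2), of p]
    by (simp add: tangent_space_def cpx_vec_def complex_eq_iff)
  then show ?thesis
    using assms by (simp add: smooth_vf_def) (simp add: cpx_vec_def smooth_fun_Complex)
qed

section \<open>The splitting of the tangent bundle\<close>

locale pseudo_hermitian =
  fixes A :: "('a::{t2_space, second_countable_topology}, 'n::finite) chart set"
    and m :: nat and H :: "'a \<Rightarrow> 'a ctvec set" and \<theta> :: "'a \<Rightarrow> 'a tvec \<Rightarrow> real"
    and \<xi> :: "'a vfield" and J :: "'a \<Rightarrow> 'a tvec \<Rightarrow> 'a tvec"
    and h :: "'a \<Rightarrow> 'a tvec \<Rightarrow> 'a tvec \<Rightarrow> real"
  assumes pseudo_hermitian: "pseudo_hermitian_manifold A m H \<theta> \<xi> J h"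

sublocale pseudo_hermitian \<subseteq> smooth_manifold
  using pseudo_hermitian by unfold_locales
    (simp add: pseudo_hermitian_manifold_def cr_structure_def)

context pseudo_hermitian
begin

lemma theta_form: "one_form A \<theta>"
  using pseudo_hermitian by (simp add: pseudo_hermitian_manifold_def pseudo_hermitian_form_def)

lemma theta_add: "u \<in> TM p \<Longrightarrow> v \<in> TM p \<Longrightarrow> \<theta> p (u + v) = \<theta> p u + \<theta> p v"
  using theta_form by (simp add: one_form_def)

lemma theta_scale: "u \<in> TM p \<Longrightarrow> \<theta> p (scale_vec r u) = r * \<theta> p u"
  using theta_form by (simp add: one_form_def)

lemma theta_smooth: "vf X \<Longrightarrow> smooth_fun A (\<lambda>p. \<theta> p (X p))"
  using theta_form by (simp add: one_form_def)

lemma theta_diff: "u \<in> TM p \<Longrightarrow> v \<in> TM p \<Longrightarrow> \<theta> p (u - v) = \<theta> p u - \<theta> p v"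
  using theta_add[of "u - v" p v] tangent_diff[of u p v] by simp

lemma theta_zero: "\<theta> p 0 = 0"
  using theta_diff[of 0 p 0] by simp

text \<open>As the kernel of \<open>\<theta>\<close>, the distribution \<open>H(M)\<close> inherits its linear structure from the tangent
  bundle, without recourse to the complex bundle.\<close>

lemma levi_dist_iff: "v \<in> levi_dist H p \<longleftrightarrow> v \<in> TM p \<and> \<theta> p v = 0"
proof -
  have "{v \<in> TM p. \<theta> p v = 0} = levi_dist H p"
    using pseudo_hermitian by (simp add: pseudo_hermitian_manifold_def pseudo_hermitian_form_def)
  then show ?thesis by blast
qed

lemma vf_xi: "vf \<xi>" and theta_xi [simp]: "\<theta> p (\<xi> p) = 1"
  and d_theta_xi: "vf X \<Longrightarrow> d_one A \<theta> \<xi> X p = 0"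
  using pseudo_hermitian by (simp_all add: pseudo_hermitian_manifold_def reeb_field_def)

lemma xi_tangent: "\<xi> p \<in> TM p"
  using vf_xi by (rule vf_tangent)

text \<open>This is \<open>i\<^sub>\<xi>d\<theta> = 0\<close> combined with \<open>\<theta>(\<xi>) = 1\<close>: the flow of \<open>\<xi>\<close> preserves \<open>\<theta>\<close>.\<close>

lemma theta_bracket_xi:
  assumes "vf X"
  shows "\<theta> p (bracket A \<xi> X p) = \<xi> p (\<lambda>q. \<theta> q (X q))"
  using d_theta_xi[OF assms, of p] tangent_const[OF vf_tangent[OF assms], of p 1]
  by (simp add: d_one_def)

text \<open>The projection \<open>\<pi>\<^sub>H\<close> in closed form; it agrees with \<open>pi_H\<close> on tangent vectors, where \<open>pi_H\<close> is
  well defined.\<close>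

definition hor :: "'a \<Rightarrow> 'a tvec \<Rightarrow> 'a tvec" where
  "hor p v = v - scale_vec (\<theta> p v) (\<xi> p)"

lemma hor_levi: "v \<in> TM p \<Longrightarrow> hor p v \<in> levi_dist H p"
  by (simp add: hor_def levi_dist_iff tangent_diff tangent_scale xi_tangent theta_diff theta_scale)

lemma pi_H_eq_hor:
  assumes "v \<in> TM p"
  shows "pi_H H \<xi> p v = hor p v"
  unfolding pi_H_def
proof (rule the_equality)
  show "hor p v \<in> levi_dist H p \<and> (\<exists>r. v = hor p v + scale_vec r (\<xi> p))"
    using hor_levi[OF assms] by (auto simp: hor_def)
next
  fix w assume w: "w \<in> levi_dist H p \<and> (\<exists>r. v = w + scale_vec r (\<xi> p))"
  then obtain r where r: "v = w + scale_vec r (\<xi> p)" by blast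
  then have "\<theta> p v = r"
    using w by (simp add: levi_dist_iff theta_add theta_scale tangent_scale xi_tangent)
  then show "w = hor p v" using r by (simp add: hor_def)
qed

lemma hor_id: "v \<in> levi_dist H p \<Longrightarrow> hor p v = v"
  by (auto simp: hor_def levi_dist_iff scale_vec_def)

lemma hor_xi: "hor p (\<xi> p) = 0"
  by (auto simp: hor_def scale_vec_def)

lemma hor_add: "u \<in> TM p \<Longrightarrow> v \<in> TM p \<Longrightarrow> hor p (u + v) = hor p u + hor p v"
  by (simp add: hor_def theta_add) (simp add: scale_vec_def fun_eq_iff algebra_simps)

lemma hor_scale: "u \<in> TM p \<Longrightarrow> hor p (scale_vec r u) = scale_vec r (hor p u)"
  by (simp add: hor_def theta_scale) (simp add: scale_vec_def fun_eq_iff algebra_simps)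

lemma levi_add: "u \<in> levi_dist H p \<Longrightarrow> v \<in> levi_dist H p \<Longrightarrow> u + v \<in> levi_dist H p"
  by (simp add: levi_dist_iff theta_add tangent_add)

lemma levi_tangent: "u \<in> levi_dist H p \<Longrightarrow> u \<in> TM p"
  by (simp add: levi_dist_iff)

lemma section_hor: "vf X \<Longrightarrow> section_of A (levi_dist H) (\<lambda>p. hor p (X p))"
proof -
  assume X: "vf X"
  have "vf (X - scale_vf (\<lambda>p. \<theta> p (X p)) \<xi>)"
    by (intro vf_diff vf_scale vf_xi theta_smooth X)
  also have "X - scale_vf (\<lambda>p. \<theta> p (X p)) \<xi> = (\<lambda>p. hor p (X p))"
    by (simp add: fun_eq_iff hor_def scale_vf_def)
  finally show ?thesis using X by (simp add: section_of_def hor_levi vf_tangent)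
qed

section \<open>The complex structure on the Levi distribution\<close>

lemma H_span: "\<exists>Z. H p = {(\<lambda>f. \<Sum>i<m. c i * Z i f) | c. True}"
proof -
  have "complex_subbundle A m H"
    using pseudo_hermitian by (simp add: pseudo_hermitian_manifold_def cr_structure_def)
  then have "\<exists>U Z. open U \<and> p \<in> U \<and> (\<forall>i<m. smooth_vf A (Z i)) \<and>
     (\<forall>q\<in>U. H q = {(\<lambda>f. \<Sum>i<m. c i * Z i q f) | c. True} \<and>
        (\<forall>c. (\<forall>f. (\<Sum>i<m. c i * Z i q f) = 0) \<longrightarrow> (\<forall>i<m. c i = 0)))"
    unfolding complex_subbundle_def by (rule spec)
  then obtain U Z where U: "p \<in> U"
    and Z: "\<forall>q\<in>U. H q = {(\<lambda>f. \<Sum>i<m. c i * Z i q f) | c. True} \<and>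
        (\<forall>c. (\<forall>f. (\<Sum>i<m. c i * Z i q f) = 0) \<longrightarrow> (\<forall>i<m. c i = 0))"
    by (elim exE conjE)
  show ?thesis using bspec[OF Z U] by (intro exI[of _ "\<lambda>i. Z i p"]) (rule conjunct1)
qed

lemma H_add: "z \<in> H p \<Longrightarrow> w \<in> H p \<Longrightarrow> z + w \<in> H p"
proof -
  assume "z \<in> H p" "w \<in> H p"
  moreover obtain Z where Z: "H p = {(\<lambda>f. \<Sum>i<m. c i * Z i f) | c. True}" using H_span by blast
  ultimately obtain c d where "z = (\<lambda>f. \<Sum>i<m. c i * Z i f)" "w = (\<lambda>f. \<Sum>i<m. d i * Z i f)"
    by auto
  then have "z + w = (\<lambda>f. \<Sum>i<m. (c i + d i) * Z i f)"
    by (simp add: fun_eq_iff sum.distrib algebra_simps)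
  then show ?thesis unfolding Z mem_Collect_eq by (intro exI[of _ "\<lambda>i. c i + d i"]) simp
qed

lemma H_scale: "z \<in> H p \<Longrightarrow> scale_vec a z \<in> H p"
proof -
  assume "z \<in> H p"
  moreover obtain Z where Z: "H p = {(\<lambda>f. \<Sum>i<m. c i * Z i f) | c. True}" using H_span by blast
  ultimately obtain c where "z = (\<lambda>f. \<Sum>i<m. c i * Z i f)"
    by auto
  then have "scale_vec a z = (\<lambda>f. \<Sum>i<m. (a * c i) * Z i f)"
    by (simp add: fun_eq_iff scale_vec_def sum_distrib_left algebra_simps)
  then show ?thesis unfolding Z mem_Collect_eq by (intro exI[of _ "\<lambda>i. a * c i"]) simp
qed

text \<open>A purely imaginary element of \<open>H\<^sup>1\<^sup>,\<^sup>0\<close> also lies in \<open>H\<^sup>0\<^sup>,\<^sup>1\<close>. This is what makes \<open>J_b\<close> well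
  defined.\<close>

lemma H_real_trivial:
  assumes "z \<in> H p" "conj_vec z = scale_vec (-1) z"
  shows "z = 0"
proof -
  have "scale_vec (-1) z \<in> H p" using assms(1) by (rule H_scale)
  moreover have "z = conj_vec (scale_vec (-1) z)"
    using assms(2) by (simp add: fun_eq_iff conj_vec_def scale_vec_def)
  ultimately have "z \<in> H p \<inter> conj_bundle H p"
    using assms(1) unfolding conj_bundle_def by blast
  moreover have "H p \<inter> conj_bundle H p = {0}"
    using pseudo_hermitian by (simp add: pseudo_hermitian_manifold_def cr_structure_def)
  ultimately show ?thesis by simp
qed

text \<open>Together with \<open>levi_of_cpx\<close> and \<open>cpx_J_b\<close> this identifies \<open>H\<^sup>1\<^sup>,\<^sup>0\<close> as the set of all
  \<open>J\<^sub>bv + \<i>v\<close> with \<open>v \<in> H(M)\<close>, that is, up to the factor \<open>\<i>\<close>, as the usual \<open>v - \<i>J\<^sub>bv\<close>. The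
  representative with \<open>v\<close> as imaginary part avoids signs later on.\<close>

lemma J_b_eqI:
  assumes w: "cpx_vec a b \<in> H p"
  shows "J_b H p b = a"
  unfolding J_b_def
proof (rule the_equality)
  \<comment> \<open>If \<open>w = a + \<i>b\<close>, then \<open>z = -\<i>w/2 = (b - \<i>a)/2\<close> has \<open>z + \<close> its conjugate equal to \<open>b\<close>.\<close>
  define z where "z = scale_vec (- \<i> / 2) (cpx_vec a b)"
  have z: "z \<in> H p" unfolding z_def using w by (rule H_scale)
  have zb: "cx_vec b = z + conj_vec z" and za: "cx_vec a = scale_vec \<i> (z - conj_vec z)"
    by (simp_all add: fun_eq_iff complex_eq_iff z_def scale_vec_def conj_vec_def cx_vec_def
        cpx_vec_def)
  show "\<exists>z\<in>H p. cx_vec b = z + conj_vec z \<and> cx_vec a = scale_vec \<i> (z - conj_vec z)"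
    using z zb za by blast
  fix u assume "\<exists>z\<in>H p. cx_vec b = z + conj_vec z \<and> cx_vec u = scale_vec \<i> (z - conj_vec z)"
  then obtain y where y: "y \<in> H p" "cx_vec b = y + conj_vec y"
    "cx_vec u = scale_vec \<i> (y - conj_vec y)" by blast
  have "z + scale_vec (-1) y \<in> H p" using z y by (intro H_add H_scale)
  moreover have "conj_vec (z + scale_vec (-1) y) = scale_vec (-1) (z + scale_vec (-1) y)"
    using zb y(2) by (auto simp: fun_eq_iff conj_vec_def scale_vec_def algebra_simps)
  ultimately have "z + scale_vec (-1) y = 0" by (rule H_real_trivial)
  then have "z = y" by (simp add: fun_eq_iff scale_vec_def)
  then have "cx_vec u = cx_vec a" using za y by simp
  then show "u = a" by (simp add: fun_eq_iff cx_vec_def)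
qed

lemma levi_of_cpx:
  assumes w: "cpx_vec a b \<in> H p"
  shows "b \<in> levi_dist H p"
proof -
  define z where "z = scale_vec (- \<i> / 2) (cpx_vec a b)"
  have "z \<in> H p" unfolding z_def using w by (rule H_scale)
  moreover have "b = re_vec (z + conj_vec z)"
    by (simp add: fun_eq_iff z_def scale_vec_def conj_vec_def re_vec_def cpx_vec_def)
  ultimately show ?thesis unfolding levi_dist_def conj_bundle_def by blast
qed

lemma cpx_J_b:
  assumes "v \<in> levi_dist H p"
  shows "cpx_vec (J_b H p v) v \<in> H p"
proof -
  obtain z w where zw: "z \<in> H p" "w \<in> H p" "v = re_vec (z + conj_vec w)"
    using assms unfolding levi_dist_def conj_bundle_def by blast
  define y where "y = scale_vec \<i> (z + w)"
  have "y \<in> H p" unfolding y_def using zw by (intro H_scale H_add)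
  moreover have "y = cpx_vec (re_vec y) v"
    using zw(3) by (auto simp: fun_eq_iff complex_eq_iff y_def scale_vec_def cpx_vec_def re_vec_def
        conj_vec_def)
  ultimately have "cpx_vec (re_vec y) v \<in> H p" by simp
  moreover from this have "J_b H p v = re_vec y" by (rule J_b_eqI)
  ultimately show ?thesis by simp
qed

text \<open>Both follow from \<open>\<i>(J\<^sub>bv + \<i>v) = -v + \<i>J\<^sub>bv\<close>, which lies in \<open>H\<^sup>1\<^sup>,\<^sup>0\<close> and therefore shows that
  \<open>-v\<close> is the image of \<open>J\<^sub>bv\<close>.\<close>

lemma J_b_levi: "v \<in> levi_dist H p \<Longrightarrow> J_b H p v \<in> levi_dist H p"
  and J_b_J_b: "v \<in> levi_dist H p \<Longrightarrow> J_b H p (J_b H p v) = scale_vec (-1) v"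
proof -
  assume "v \<in> levi_dist H p"
  then have "scale_vec \<i> (cpx_vec (J_b H p v) v) \<in> H p" by (intro H_scale cpx_J_b)
  moreover have "scale_vec \<i> (cpx_vec (J_b H p v) v) = cpx_vec (scale_vec (-1) v) (J_b H p v)"
    by (simp add: fun_eq_iff complex_eq_iff scale_vec_def cpx_vec_def)
  ultimately have "cpx_vec (scale_vec (-1) v) (J_b H p v) \<in> H p" by simp
  then show "J_b H p v \<in> levi_dist H p" "J_b H p (J_b H p v) = scale_vec (-1) v"
    by (auto intro: levi_of_cpx J_b_eqI)
qed

lemma J_endo: "cr_endomorphism A H \<xi> J"
  using pseudo_hermitian by (simp add: pseudo_hermitian_manifold_def)

lemma J_tangent: "u \<in> TM p \<Longrightarrow> J p u \<in> TM p"
  using J_endo by (simp only: cr_endomorphism_def)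

lemma J_add: "u \<in> TM p \<Longrightarrow> v \<in> TM p \<Longrightarrow> J p (u + v) = J p u + J p v"
  using J_endo by (simp only: cr_endomorphism_def)

lemma J_scale: "u \<in> TM p \<Longrightarrow> J p (scale_vec r u) = scale_vec r (J p u)"
  using J_endo by (simp only: cr_endomorphism_def)

lemma vf_J: "vf X \<Longrightarrow> vf (\<lambda>p. J p (X p))"
  using J_endo by (simp only: cr_endomorphism_def)

lemma J_eq_J_b: "u \<in> levi_dist H p \<Longrightarrow> J p u = J_b H p u"
  using J_endo by (simp only: cr_endomorphism_def)

lemma J_xi: "J p (\<xi> p) = 0"
  using J_endo by (simp only: cr_endomorphism_def)

lemma J_diff: "u \<in> TM p \<Longrightarrow> v \<in> TM p \<Longrightarrow> J p (u - v) = J p u - J p v"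
  using J_add[of "u - v" p v] tangent_diff[of u p v] by simp

lemma J_zero: "J p 0 = 0"
  using J_diff[of 0 p 0] by simp

lemma J_hor: "u \<in> TM p \<Longrightarrow> J p (hor p u) = J p u"
  by (simp add: hor_def J_diff J_scale J_xi tangent_scale xi_tangent)
    (simp add: scale_vec_def fun_eq_iff)

lemma J_eq: "u \<in> TM p \<Longrightarrow> J p u = J_b H p (hor p u)"
  unfolding J_eq_J_b[OF hor_levi, symmetric] by (rule J_hor[symmetric])

lemma J_levi: "u \<in> TM p \<Longrightarrow> J p u \<in> levi_dist H p"
  unfolding J_eq by (intro J_b_levi hor_levi)

lemma J_J:
  assumes "u \<in> TM p"
  shows "J p (J p u) = scale_vec (-1) (hor p u)"
  unfolding J_eq_J_b[OF J_levi[OF assms]] unfolding J_eq[OF assms]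
  by (rule J_b_J_b[OF hor_levi[OF assms]])

section \<open>The transverse metric\<close>

abbreviation k :: "'a \<Rightarrow> 'a tvec \<Rightarrow> 'a tvec \<Rightarrow> real" where "k \<equiv> h_tensor H \<xi> h"

lemma h_metric: "hermitian_fiber_metric A H h"
  using pseudo_hermitian by (simp add: pseudo_hermitian_manifold_def)

lemma k_eq: "u \<in> TM p \<Longrightarrow> v \<in> TM p \<Longrightarrow> k p u v = h p (hor p u) (hor p v)"
  by (simp add: h_tensor_def pi_H_eq_hor)

lemma k_sym: "u \<in> TM p \<Longrightarrow> v \<in> TM p \<Longrightarrow> k p u v = k p v u"
  using h_metric hor_levi by (simp add: k_eq hermitian_fiber_metric_def)

lemma k_add_left:
  "u \<in> TM p \<Longrightarrow> v \<in> TM p \<Longrightarrow> w \<in> TM p \<Longrightarrow> k p (u + v) w = k p u w + k p v w"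
  using h_metric hor_levi
  by (simp add: k_eq tangent_add hor_add hermitian_fiber_metric_def)

lemma k_scale_left: "u \<in> TM p \<Longrightarrow> v \<in> TM p \<Longrightarrow> k p (scale_vec r u) v = r * k p u v"
  using h_metric hor_levi
  by (simp add: k_eq tangent_scale hor_scale hermitian_fiber_metric_def)

lemma k_diff_left:
  "u \<in> TM p \<Longrightarrow> v \<in> TM p \<Longrightarrow> w \<in> TM p \<Longrightarrow> k p (u - v) w = k p u w - k p v w"
  using k_add_left[of "u - v" p v w] tangent_diff[of u p v] by simp

lemma k_diff_right:
  "u \<in> TM p \<Longrightarrow> v \<in> TM p \<Longrightarrow> w \<in> TM p \<Longrightarrow> k p w (u - v) = k p w u - k p w v"
  using k_diff_left[of u p v w] by (simp add: k_sym[of w] tangent_diff)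

lemma k_add_right:
  "u \<in> TM p \<Longrightarrow> v \<in> TM p \<Longrightarrow> w \<in> TM p \<Longrightarrow> k p w (u + v) = k p w u + k p w v"
  using k_add_left[of u p v w] by (simp add: k_sym[of w] tangent_add)

lemma k_hor_left: "u \<in> TM p \<Longrightarrow> v \<in> TM p \<Longrightarrow> k p (hor p u) v = k p u v"
  by (simp add: k_eq levi_tangent hor_levi hor_id)

lemma k_zero_left: "v \<in> TM p \<Longrightarrow> k p 0 v = 0"
  using k_diff_left[of 0 p 0 v] by simp

lemma k_xi_left: "v \<in> TM p \<Longrightarrow> k p (\<xi> p) v = 0"
  using k_hor_left[of "\<xi> p" p v] by (simp add: xi_tangent hor_xi k_zero_left)

lemma k_J_J:
  assumes "u \<in> TM p" "v \<in> TM p"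
  shows "k p (J p u) (J p v) = k p u v"
proof -
  have "k p (J p u) (J p v) = h p (J_b H p (hor p u)) (J_b H p (hor p v))"
    unfolding J_eq_J_b[OF hor_levi[OF assms(1)], symmetric]
      J_eq_J_b[OF hor_levi[OF assms(2)], symmetric]
    by (simp add: k_eq J_tangent hor_id J_levi J_hor assms)
  also have "\<dots> = h p (hor p u) (hor p v)"
    using h_metric hor_levi assms by (simp add: hermitian_fiber_metric_def)
  finally show ?thesis using assms by (simp add: k_eq)
qed

lemma k_J_J_left: "u \<in> TM p \<Longrightarrow> v \<in> TM p \<Longrightarrow> k p (J p (J p u)) v = - k p u v"
  by (simp add: J_J k_scale_left levi_tangent hor_levi k_hor_left)

text \<open>An isometry of \<open>H(M)\<close> that squares to \<open>-1\<close> is skew, and \<open>\<xi>\<close> lies in the kernel of both \<open>J\<close> and \<open>k\<close>.\<close>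

lemma k_J_left: "u \<in> TM p \<Longrightarrow> v \<in> TM p \<Longrightarrow> k p (J p u) v = - k p u (J p v)"
  using k_J_J[of "J p u" p v] k_J_J_left[of u p "J p v"] by (simp add: J_tangent)

lemma k_definite:
  assumes u: "u \<in> levi_dist H p" and "k p u u = 0"
  shows "u = 0"
proof -
  have "h p u u = 0" using assms by (simp add: k_eq levi_tangent hor_id)
  moreover have "u \<noteq> 0 \<longrightarrow> 0 < h p u u"
    using h_metric u by (simp add: hermitian_fiber_metric_def)
  ultimately show ?thesis by auto
qed

lemma k_smooth: "vf X \<Longrightarrow> vf Y \<Longrightarrow> smooth_fun A (\<lambda>p. k p (X p) (Y p))"
  using h_metric section_hor[of X] section_hor[of Y]
  by (simp add: k_eq vf_tangent hermitian_fiber_metric_def)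

end

section \<open>Connections adapted to the splitting\<close>

locale canonical_pseudo_hermitian = pseudo_hermitian A m H \<theta> \<xi> J h
  for A :: "('a::{t2_space, second_countable_topology}, 'n::finite) chart set"
    and m H \<theta> \<xi> J h +
  fixes N :: "'a vfield \<Rightarrow> 'a vfield \<Rightarrow> 'a vfield"
  assumes canonical: "canonical_connection A H \<theta> \<xi> J h N"
begin

lemma connection: "linear_connection A N"
  and N_H: "preserves_bundle A N H"
  and N_reeb: "preserves_bundle A N (reeb_line \<xi>)"
  and N_metric: "preserves_metric A N (g_metric H \<theta> \<xi> h)"
  using canonical by (simp_all add: canonical_connection_def pseudo_hermitian_connection_def)

lemma N_vf: "vf X \<Longrightarrow> vf Y \<Longrightarrow> vf (N X Y)"
  by (rule connection[unfolded linear_connection_def, THEN conjunct1, rule_format])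
    (intro conjI)

lemma N_add_left: "vf X \<Longrightarrow> vf X' \<Longrightarrow> vf Y \<Longrightarrow> N (X + X') Y = N X Y + N X' Y"
  by (rule connection[unfolded linear_connection_def, THEN conjunct2, THEN conjunct1, rule_format])
    (intro conjI)

lemma N_add_right: "vf X \<Longrightarrow> vf Y \<Longrightarrow> vf Y' \<Longrightarrow> N X (Y + Y') = N X Y + N X Y'"
  by (rule connection[unfolded linear_connection_def, THEN conjunct2, THEN conjunct2, THEN conjunct1, rule_format])
    (intro conjI)

lemma N_scale_right: "smooth_fun A u \<Longrightarrow> vf X \<Longrightarrow> vf Y \<Longrightarrow>
    N X (scale_vf u Y) = scale_vf u (N X Y) + scale_vf (\<lambda>p. X p u) Y"
  by (rule connection[unfolded linear_connection_def, THEN conjunct2, THEN conjunct2, THEN conjunct2, THEN conjunct2, rule_format])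
    (intro conjI)

lemma N_zero_left: "vf Y \<Longrightarrow> N 0 Y = 0"
  using N_add_left[OF vf_zero vf_zero, of Y] by simp

lemma N_tangent: "vf X \<Longrightarrow> vf Y \<Longrightarrow> N X Y p \<in> TM p"
  by (intro vf_tangent N_vf)

lemma cx_ext_N:
  assumes "vf X" "vf Y" "vf Z"
  shows "cx_ext N (cx_vec \<circ> X) (\<lambda>p. cpx_vec (Y p) (Z p)) = (\<lambda>p. cpx_vec (N X Y p) (N X Z p))"
proof -
  have "re_vec \<circ> (cx_vec \<circ> X) = X" "im_vec \<circ> (cx_vec \<circ> X) = 0"
    "re_vec \<circ> (\<lambda>p. cpx_vec (Y p) (Z p)) = Y" "im_vec \<circ> (\<lambda>p. cpx_vec (Y p) (Z p)) = Z"
    by (simp_all add: fun_eq_iff re_vec_def im_vec_def cx_vec_def cpx_vec_def)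
  then show ?thesis
    by (simp add: cx_ext_def cpx_vec_def N_zero_left assms)
qed

lemma g_eq: "g_metric H \<theta> \<xi> h p u v = k p u v + \<theta> p u * \<theta> p v"
  by (simp add: g_metric_def)

lemma N_g:
  assumes "vf X" "vf Y" "vf Z"
  shows "X p (\<lambda>q. k q (Y q) (Z q) + \<theta> q (Y q) * \<theta> q (Z q)) =
    k p (N X Y p) (Z p) + \<theta> p (N X Y p) * \<theta> p (Z p) +
    (k p (Y p) (N X Z p) + \<theta> p (Y p) * \<theta> p (N X Z p))"
  by (rule N_metric[unfolded preserves_metric_def g_eq, rule_format,
        OF conjI[OF assms(1) conjI[OF assms(2,3)]]])

lemma k_xi_right: "v \<in> TM p \<Longrightarrow> k p v (\<xi> p) = 0"
  using k_xi_left k_sym xi_tangent by simp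

text \<open>Preserving the line \<open>\<complex>\<xi>\<close> forces \<open>\<nabla>\<^sub>X\<xi>\<close> to be a multiple of \<open>\<xi>\<close>, and preserving the length of
  \<open>\<xi>\<close> forces the multiple to be zero.\<close>

lemma N_xi:
  assumes X: "vf X"
  shows "N X \<xi> = 0"
proof (rule ext)
  fix p
  have "section_of A (reeb_line \<xi>) (\<lambda>p. cpx_vec (\<xi> p) ((0 :: 'a vfield) p))"
    unfolding section_of_def
  proof (intro conjI allI)
    show "smooth_vf A (\<lambda>p. cpx_vec (\<xi> p) ((0 :: 'a vfield) p))"
      by (intro smooth_vf_cpx_vec vf_xi vf_zero)
    show "cpx_vec (\<xi> p) ((0 :: 'a vfield) p) \<in> reeb_line \<xi> p" for p
      unfolding reeb_line_def mem_Collect_eq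
      by (intro exI[of _ 1])
        (simp add: fun_eq_iff scale_vec_def cx_vec_def cpx_vec_def complex_eq_iff)
  qed
  then have "section_of A (reeb_line \<xi>) (\<lambda>p. cpx_vec (N X \<xi> p) (N X 0 p))"
    unfolding cx_ext_N[OF X vf_xi vf_zero, symmetric]
    by (rule N_reeb[unfolded preserves_bundle_def, rule_format, OF conjI[OF X]])
  then have "cpx_vec (N X \<xi> p) (N X 0 p) \<in> reeb_line \<xi> p" by (simp add: section_of_def)
  then obtain c where c: "cpx_vec (N X \<xi> p) (N X 0 p) = scale_vec c (cx_vec (\<xi> p))"
    unfolding reeb_line_def by blast
  have line: "N X \<xi> p = scale_vec (Re c) (\<xi> p)"
  proof
    fix f
    show "N X \<xi> p f = scale_vec (Re c) (\<xi> p) f"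
      using arg_cong[OF fun_cong[OF c, of f], of Re]
      by (simp add: cpx_vec_def scale_vec_def cx_vec_def)
  qed
  have "(\<lambda>q. k q (\<xi> q) (\<xi> q) + \<theta> q (\<xi> q) * \<theta> q (\<xi> q)) = (\<lambda>q. 1)"
    by (simp add: k_xi_left xi_tangent)
  then have "0 = 2 * \<theta> p (N X \<xi> p)"
    using N_g[OF X vf_xi vf_xi, of p] tangent_const[OF vf_tangent[OF X]]
    by (simp add: k_xi_left k_xi_right N_tangent X vf_xi)
  then have "Re c = 0" unfolding line by (simp add: theta_scale xi_tangent)
  then show "N X \<xi> p = 0 p" unfolding line by (simp add: scale_vec_def fun_eq_iff)
qed

text \<open>The form \<open>\<theta>\<close> is the metric dual of \<open>\<xi>\<close>, so it is parallel because \<open>\<xi>\<close> and the metric are.\<close>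

lemma N_theta:
  assumes X: "vf X" and Y: "vf Y"
  shows "X p (\<lambda>q. \<theta> q (Y q)) = \<theta> p (N X Y p)"
  using N_g[OF X Y vf_xi, of p] k_sym[OF vf_tangent[OF Y] tangent_zero, of p]
  by (simp add: N_xi[OF X] k_xi_right k_zero_left vf_tangent[OF Y] N_tangent[OF X Y] theta_zero)

text \<open>Since \<open>k = g - \<theta> \<otimes> \<theta>\<close>, this follows from \<open>\<nabla>g = 0\<close> and \<open>\<nabla>\<theta> = 0\<close>.\<close>

lemma N_k:
  assumes X: "vf X" and Y: "vf Y" and Z: "vf Z"
  shows "X p (\<lambda>q. k q (Y q) (Z q)) = k p (N X Y p) (Z p) + k p (Y p) (N X Z p)"
proof -
  note sm = k_smooth[OF Y Z] theta_smooth[OF Y] theta_smooth[OF Z]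
  have "X p (\<lambda>q. k q (Y q) (Z q) + \<theta> q (Y q) * \<theta> q (Z q)) =
      X p (\<lambda>q. k q (Y q) (Z q)) + X p (\<lambda>q. \<theta> q (Y q) * \<theta> q (Z q))"
    by (rule tangent_plus_fun[OF vf_tangent[OF X] sm(1) smooth_fun_mult[OF sm(2,3)]])
  also have "X p (\<lambda>q. \<theta> q (Y q) * \<theta> q (Z q)) =
      \<theta> p (Y p) * \<theta> p (N X Z p) + \<theta> p (Z p) * \<theta> p (N X Y p)"
    using tangent_leibniz[OF vf_tangent[OF X] sm(2,3)] by (simp add: N_theta X Y Z)
  finally show ?thesis using N_g[OF X Y Z, of p] by simp
qed

lemma N_hor:
  assumes X: "vf X" and Y: "vf Y"
  shows "N X (\<lambda>q. hor q (Y q)) p = hor p (N X Y p)"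
proof -
  define V where "V = (\<lambda>q. hor q (Y q))"
  define W where "W = scale_vf (\<lambda>q. \<theta> q (Y q)) \<xi>"
  have V: "vf V" using section_hor[OF Y] by (simp add: V_def section_of_def)
  have W: "vf W" unfolding W_def by (intro vf_scale theta_smooth vf_xi Y)
  have "Y = V + W" by (simp add: V_def W_def hor_def scale_vf_def fun_eq_iff)
  then have "N X Y = N X V + N X W" using N_add_right[OF X V W] by simp
  moreover have "N X W p = scale_vec (\<theta> p (N X Y p)) (\<xi> p)"
    unfolding W_def N_scale_right[OF theta_smooth[OF Y] X vf_xi] N_xi[OF X]
    by (simp add: N_theta X Y scale_vf_def scale_vec_def fun_eq_iff)
  ultimately show ?thesis unfolding V_def[symmetric] by (simp add: hor_def)
qed

text \<open>On horizontal fields, \<open>JV + \<i>V\<close> is a section of \<open>H\<^sup>1\<^sup>,\<^sup>0\<close>, hence so is \<open>\<nabla>\<^sub>X(JV) + \<i>\<nabla>\<^sub>XV\<close>, which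
  says \<open>J\<nabla>\<^sub>XV = \<nabla>\<^sub>X(JV)\<close>. The vertical part of a field is killed by \<open>J\<close>, before and after
  differentiation (\<open>N_hor\<close>).\<close>

lemma N_J:
  assumes X: "vf X" and Y: "vf Y"
  shows "N X (\<lambda>q. J q (Y q)) p = J p (N X Y p)"
proof -
  define V where "V = (\<lambda>q. hor q (Y q))"
  have V: "vf V" and VH: "V q \<in> levi_dist H q" for q
    using section_hor[OF Y] by (simp_all add: V_def section_of_def)
  have JV: "J q (V q) = J q (Y q)" for q
    by (simp add: V_def J_hor vf_tangent[OF Y])
  have JY: "vf (\<lambda>q. J q (Y q))" using Y by (rule vf_J)
  have "section_of A H (\<lambda>q. cpx_vec (J q (Y q)) (V q))"
    unfolding section_of_def
  proof (intro conjI allI)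
    show "smooth_vf A (\<lambda>q. cpx_vec (J q (Y q)) (V q))" using JY V by (rule smooth_vf_cpx_vec)
    show "cpx_vec (J q (Y q)) (V q) \<in> H q" for q
      using cpx_J_b[OF VH] by (simp add: J_eq_J_b[OF VH, symmetric] JV)
  qed
  then have "section_of A H (\<lambda>q. cpx_vec (N X (\<lambda>q. J q (Y q)) q) (N X V q))"
    unfolding cx_ext_N[OF X JY V, symmetric]
    by (rule N_H[unfolded preserves_bundle_def, rule_format, OF conjI[OF X]])
  then have *: "cpx_vec (N X (\<lambda>q. J q (Y q)) p) (N X V p) \<in> H p" by (simp add: section_of_def)
  have "N X V p = hor p (N X Y p)" unfolding V_def by (rule N_hor[OF X Y])
  then have "J p (N X V p) = J p (N X Y p)" by (simp add: J_hor N_tangent X Y)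
  then show ?thesis using J_b_eqI[OF *] J_eq_J_b[OF levi_of_cpx[OF *]] by simp
qed

section \<open>The torsion along the Reeb field\<close>

abbreviation \<tau> :: "'a vfield \<Rightarrow> 'a vfield" where "\<tau> \<equiv> tau A \<xi> N"

abbreviation JF :: "'a vfield \<Rightarrow> 'a vfield" where "JF X \<equiv> (\<lambda>p. J p (X p))"

lemma tau_eq: "vf X \<Longrightarrow> \<tau> X = N \<xi> X - bracket A \<xi> X"
  by (simp add: tau_def torsion_def N_xi)

lemma bracket_eq: "vf X \<Longrightarrow> bracket A \<xi> X p = N \<xi> X p - \<tau> X p"
  by (simp add: tau_eq)

lemma vf_tau: "vf X \<Longrightarrow> vf (\<tau> X)"
  by (simp add: tau_eq vf_diff N_vf vf_bracket vf_xi)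

text \<open>\<open>\<theta>(\<nabla>\<^sub>\<xi>X)\<close> and \<open>\<theta>([\<xi>, X])\<close> are both the derivative of \<open>\<theta>(X)\<close> along \<open>\<xi>\<close>.\<close>

lemma tau_levi: "vf X \<Longrightarrow> \<tau> X p \<in> levi_dist H p"
  using vf_tangent[OF vf_tau]
  by (simp add: levi_dist_iff)
    (simp add: tau_eq theta_diff N_tangent vf_xi vf_tangent vf_bracket theta_bracket_xi N_theta)

lemma tau_tangent: "vf X \<Longrightarrow> \<tau> X p \<in> TM p"
  by (intro vf_tangent vf_tau)

text \<open>The terms with \<open>\<nabla>\<^sub>\<xi>\<close> cancel because \<open>J\<close> is parallel; the same happens with \<open>k\<close> in \<open>lie_k\<close>.\<close>

lemma lie_endo_J:
  assumes X: "vf X"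
  shows "lie_endo A \<xi> J X p = J p (\<tau> X p) - \<tau> (JF X) p"
  by (simp add: lie_endo_def bracket_eq X vf_J N_J vf_xi J_diff N_tangent tau_tangent)

lemma lie_k:
  assumes X: "vf X" and Y: "vf Y"
  shows "lie_two_tensor A \<xi> k X Y p = k p (\<tau> X p) (Y p) + k p (X p) (\<tau> Y p)"
  by (simp add: lie_two_tensor_def N_k bracket_eq X Y vf_xi k_diff_left k_diff_right N_tangent
      tau_tangent vf_tangent)

lemma sigma_eq: "sigma A \<xi> J N X p = \<tau> (JF X) p + J p (\<tau> X p)"
  by (simp add: sigma_def)

lemma sigma_skew:
  assumes "vf X" "vf Y"
  shows "k p (sigma A \<xi> J N X p) (Y p) = - k p (X p) (sigma A \<xi> J N Y p)"
  using canonical assms by (simp only: canonical_connection_def)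

lemma sigma_levi: "vf X \<Longrightarrow> sigma A \<xi> J N X p \<in> levi_dist H p"
  unfolding sigma_eq by (intro levi_add tau_levi vf_J J_levi tau_tangent)

lemma vf_sigma: "vf X \<Longrightarrow> vf (sigma A \<xi> J N X)"
  unfolding sigma_def by (intro vf_add vf_tau vf_J)

section \<open>The consequences of closedness of the pseudo-Kaehler form\<close>

lemma kahler_form_eq: "u \<in> TM p \<Longrightarrow> pseudo_kahler_form H \<theta> \<xi> J h p u v = k p (J p u) v"
  using J_levi[of u p] by (simp add: pseudo_kahler_form_def g_eq levi_dist_iff)

text \<open>Of the six terms of \<open>d\<Omega>(\<xi>, X, Y)\<close> those with \<open>\<xi>\<close> in a slot of \<open>\<Omega>\<close> vanish. The other three form
  \<open>(L\<^sub>\<xi>\<Omega>)(X, Y)\<close>, in which brackets with \<open>\<xi>\<close> may be replaced by \<open>-\<tau>\<close> since \<open>\<Omega>\<close> is parallel.\<close>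

lemma kahler_tau:
  assumes closed: "pseudo_kahler_type A H \<theta> \<xi> J h" and X: "vf X" and Y: "vf Y"
  shows "k p (J p (\<tau> X p)) (Y p) + k p (J p (X p)) (\<tau> Y p) = 0"
proof -
  let ?\<Omega> = "pseudo_kahler_form H \<theta> \<xi> J h"
  note tan = vf_tangent[OF X] vf_tangent[OF Y] vf_tangent[OF vf_bracket] J_tangent xi_tangent
  have 1: "(\<lambda>q. ?\<Omega> q (\<xi> q) (X q)) = (\<lambda>q. 0)" "(\<lambda>q. ?\<Omega> q (Y q) (\<xi> q)) = (\<lambda>q. 0)"
    "(\<lambda>q. ?\<Omega> q (X q) (Y q)) = (\<lambda>q. k q (J q (X q)) (Y q))"
    by (simp_all add: kahler_form_eq J_xi k_zero_left k_xi_right tan)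
  have 2: "?\<Omega> p (bracket A X Y p) (\<xi> p) = 0"
    by (simp add: kahler_form_eq tan X Y k_xi_right)
  have B: "bracket A \<xi> Y p \<in> TM p" by (intro vf_tangent vf_bracket vf_xi Y)
  have 3: "?\<Omega> p (bracket A Y \<xi> p) (X p) = k p (J p (X p)) (bracket A \<xi> Y p)"
    using k_J_left[OF B, of "X p"] k_sym[OF B, of "J p (X p)"]
    by (simp add: bracket_swap[of Y \<xi>] kahler_form_eq J_scale k_scale_left tan B tangent_scale)
  have 4: "?\<Omega> p (bracket A \<xi> X p) (Y p) = k p (J p (bracket A \<xi> X p)) (Y p)"
    by (simp add: kahler_form_eq tan vf_xi X)
  have "d_two A ?\<Omega> \<xi> X Y p = 0"
    by (rule closed[unfolded pseudo_kahler_type_def, rule_format, OF conjI[OF vf_xi conjI[OF X Y]]])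
  then have "\<xi> p (\<lambda>q. k q (J q (X q)) (Y q)) =
      k p (J p (bracket A \<xi> X p)) (Y p) + k p (J p (X p)) (bracket A \<xi> Y p)"
    unfolding d_two_def 1 2 3 4
    by (simp add: tangent_const[OF vf_tangent[OF X]] tangent_const[OF vf_tangent[OF Y]])
  then show ?thesis
    unfolding N_k[OF vf_xi vf_J[OF X] Y] N_J[OF vf_xi X] bracket_eq[OF X] bracket_eq[OF Y]
    by (simp add: J_diff k_diff_left k_diff_right N_tangent tau_tangent tan X Y vf_xi)
qed

text \<open>The identity \<open>kahler_tau\<close> says that the adjoint of \<open>\<tau>\<close> on \<open>H(M)\<close> is \<open>J\<tau>J\<close>. The two instances
  below show that \<open>\<tau>J\<close> and \<open>J\<tau>\<close> are each self-adjoint.\<close>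

lemma sigma_symmetric:
  assumes closed: "pseudo_kahler_type A H \<theta> \<xi> J h" and X: "vf X" and Y: "vf Y"
  shows "k p (sigma A \<xi> J N X p) (Y p) = k p (X p) (sigma A \<xi> J N Y p)"
proof -
  note tan = vf_tangent[OF X] vf_tangent[OF Y] vf_tangent[OF vf_J[OF X]] vf_tangent[OF vf_J[OF Y]]
    tau_tangent[OF X] tau_tangent[OF Y] tau_tangent[OF vf_J[OF X]] tau_tangent[OF vf_J[OF Y]]
    J_tangent
  have "k p (X p) (\<tau> (JF Y) p) = k p (\<tau> (JF X) p) (Y p)"
    using kahler_tau[OF closed vf_J[OF X] vf_J[OF Y], of p]
    by (simp add: k_J_J k_J_J_left tan)
  moreover have "k p (X p) (J p (\<tau> Y p)) = k p (J p (\<tau> X p)) (Y p)"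
    using kahler_tau[OF closed X Y, of p] k_J_left[of "X p" p "\<tau> Y p"] by (simp add: tan)
  ultimately show ?thesis
    by (simp add: sigma_eq k_add_left k_add_right tan)
qed

text \<open>An endomorphism that is symmetric and skew for a definite form vanishes.\<close>

lemma sigma_zero:
  assumes closed: "pseudo_kahler_type A H \<theta> \<xi> J h" and X: "vf X"
  shows "sigma A \<xi> J N X p = 0"
proof (rule k_definite[OF sigma_levi[OF X]])
  show "k p (sigma A \<xi> J N X p) (sigma A \<xi> J N X p) = 0"
    using sigma_symmetric[OF closed X vf_sigma[OF X], of p]
      sigma_skew[OF X vf_sigma[OF X], of p] by linarith
qed

lemma tau_J:
  assumes closed: "pseudo_kahler_type A H \<theta> \<xi> J h" and X: "vf X"
  shows "\<tau> (JF X) p = scale_vec (-1) (J p (\<tau> X p))"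
proof
  fix f
  have "\<tau> (JF X) p f + J p (\<tau> X p) f = 0"
    using fun_cong[OF sigma_zero[OF closed X, of p], of f] by (simp add: sigma_eq)
  then show "\<tau> (JF X) p f = scale_vec (-1) (J p (\<tau> X p)) f"
    unfolding scale_vec_def by linarith
qed

text \<open>The adjoint \<open>J\<tau>J\<close> of \<open>\<tau>\<close> equals \<open>-JJ\<tau> = \<tau>\<close> once \<open>\<tau>\<close> anticommutes with \<open>J\<close>.\<close>

lemma tau_symmetric:
  assumes closed: "pseudo_kahler_type A H \<theta> \<xi> J h" and X: "vf X" and Y: "vf Y"
  shows "k p (X p) (\<tau> Y p) = k p (\<tau> X p) (Y p)"
  using kahler_tau[OF closed vf_J[OF X] Y, of p]
  by (simp add: tau_J[OF closed X] J_scale k_scale_left k_J_J_left vf_tangent X Y tau_tangent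
      J_tangent tangent_scale)

lemma lie_endo_eq:
  assumes closed: "pseudo_kahler_type A H \<theta> \<xi> J h" and X: "vf X"
  shows "lie_endo A \<xi> J X p = scale_vec 2 (J p (\<tau> X p))"
  by (simp add: lie_endo_J X tau_J[OF closed X] scale_vec_def fun_eq_iff)

lemma lie_k_eq:
  assumes closed: "pseudo_kahler_type A H \<theta> \<xi> J h" and X: "vf X" and Y: "vf Y"
  shows "lie_two_tensor A \<xi> k X Y p = 2 * k p (\<tau> X p) (Y p)"
  by (simp add: lie_k X Y tau_symmetric[OF closed X Y])

lemma tau_zero_iff_CR:
  assumes closed: "pseudo_kahler_type A H \<theta> \<xi> J h"
  shows "(\<forall>X. vf X \<longrightarrow> \<tau> X = 0) \<longleftrightarrow> reeb_infinitesimal_CR_automorphism A \<xi> J"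
  unfolding reeb_infinitesimal_CR_automorphism_def
proof (intro iffI allI impI ext)
  fix X p f
  assume "\<forall>X. vf X \<longrightarrow> \<tau> X = 0" and X: "vf X"
  then have "\<tau> X p = 0" by simp
  then show "lie_endo A \<xi> J X p f = 0 p f"
    unfolding lie_endo_eq[OF closed X] by (simp add: J_zero scale_vec_def)
next
  fix X p f
  assume "\<forall>X. vf X \<longrightarrow> lie_endo A \<xi> J X = 0" and X: "vf X"
  then have "scale_vec 2 (J p (\<tau> X p)) = 0"
    unfolding lie_endo_eq[OF closed X, symmetric] by simp
  then have "J p (\<tau> X p) = 0" by (simp add: scale_vec_def fun_eq_iff)
  then have "k p (\<tau> X p) (\<tau> X p) = 0"
    using k_J_J[OF tau_tangent[OF X] tau_tangent[OF X], of p] by (simp add: k_zero_left)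
  then have "\<tau> X p = 0" by (rule k_definite[OF tau_levi[OF X]])
  then show "\<tau> X p f = 0 p f" by simp
qed

lemma tau_zero_iff_riemannian:
  assumes closed: "pseudo_kahler_type A H \<theta> \<xi> J h"
  shows "(\<forall>X. vf X \<longrightarrow> \<tau> X = 0) \<longleftrightarrow> reeb_riemannian_foliation A H \<xi> h"
  unfolding reeb_riemannian_foliation_def
proof (intro iffI allI impI ext)
  fix X Y p
  assume T: "\<forall>X. vf X \<longrightarrow> \<tau> X = 0" and XY: "vf X \<and> vf Y"
  then have "\<tau> X p = 0" by simp
  then show "lie_two_tensor A \<xi> k X Y p = 0"
    using lie_k_eq[OF closed, of X Y p] XY by (simp add: k_zero_left vf_tangent)
next
  fix X p f
  assume R: "\<forall>X Y p. vf X \<and> vf Y \<longrightarrow> lie_two_tensor A \<xi> k X Y p = 0" and X: "vf X"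
  have "lie_two_tensor A \<xi> k X (\<tau> X) p = 0" using R X vf_tau[OF X] by simp
  then have "k p (\<tau> X p) (\<tau> X p) = 0"
    using lie_k_eq[OF closed X vf_tau[OF X], of p] by simp
  then have "\<tau> X p = 0" by (rule k_definite[OF tau_levi[OF X]])
  then show "\<tau> X p f = 0 p f" by simp
qed

end

theorem theorem4:
  fixes A :: "('a::{t2_space, second_countable_topology}, 'n::finite) chart set"
    and m :: nat
    and H :: "'a \<Rightarrow> 'a ctvec set"
    and \<theta> :: "'a \<Rightarrow> 'a tvec \<Rightarrow> real"
    and \<xi> :: "'a vfield"
    and J :: "'a \<Rightarrow> 'a tvec \<Rightarrow> 'a tvec"
    and h :: "'a \<Rightarrow> 'a tvec \<Rightarrow> 'a tvec \<Rightarrow> real"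
    and N :: "'a vfield \<Rightarrow> 'a vfield \<Rightarrow> 'a vfield"
  assumes "pseudo_hermitian_manifold A m H \<theta> \<xi> J h"
    and "pseudo_kahler_type A H \<theta> \<xi> J h"
    and "canonical_connection A H \<theta> \<xi> J h N"
  shows "((\<forall>X. smooth_vf A X \<longrightarrow> tau A \<xi> N X = 0) \<longleftrightarrow> reeb_infinitesimal_CR_automorphism A \<xi> J) \<and>
         (reeb_infinitesimal_CR_automorphism A \<xi> J \<longleftrightarrow> reeb_riemannian_foliation A H \<xi> h)"
proof -
  interpret canonical_pseudo_hermitian A m H \<theta> \<xi> J h N
    using assms(1,3)
    by (intro canonical_pseudo_hermitian.intro pseudo_hermitian.intro
        canonical_pseudo_hermitian_axioms.intro)
  show ?thesis
    using tau_zero_iff_CR[OF assms(2)] tau_zero_iff_riemannian[OF assms(2)] by simp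
qed

end
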